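(* Let $C_x\subset\mathbb{R}^n$, $C_u\subset\mathbb{R}^m$, $C:=C_x\times C_u$, let $F:\mathbb{R}^n\times\mathbb{R}^m\rightrightarrows\mathbb{R}^n$ and $\mathcal{U}:C_x\rightrightarrows C_u$ be set-valued maps, and consider the constrained differential inclusion $\Sigma_{\mathcal U}:\ \dot x\in F(x,u),\ u\in\mathcal{U}(x),\ x\in C_x$. Assume: (A1) $C$ is closed; (A2) $F:C\rightrightarrows\mathbb{R}^n$ is upper semicontinuous and $F(x,u)$ is nonempty, compact and convex for all $(x,u)\in C$; (A3) $\mathcal{U}$ is lower semicontinuous with nonempty, closed and convex values; (A4) $F$ is convex in $u$. Let $X_o\subset C_x$ and $X_u\subset\mathbb{R}^n$ with $X_o\cap X_u=\emptyset$, let $B:\mathbb{R}^n\to\mathbb{R}$ be a locally Lipschitz control barrier function with respect to $(X_o,X_u)$ for $\Sigma_{\mathcal U}$, and let $K:=\{x\in\mathbb{R}^n: B(x)\le 0\}\cap C_x$. Suppose there exists an open neighborhood $U(\partial K)$ of $\partial K$ such that the set $$D_0(x):=\{u\in\mathcal{U}(x): g(x,u)<0\},\qquad g(x,u):=\sup\{\langle\zeta,\eta\rangle:\zeta\in\partial_C B(x),\ \eta\in F(x,u)\},$$ is nonempty for every $x\in\big(U(\partial K)\setminus\operatorname{int}(K)\big)\cap C_x$. Then there exists a continuous control law $\kappa:C_x\to C_u$ that makes $\Sigma_{\mathcal U}$ controlled safe with respect to $(X_o,X_u)$; that is, there is a continuous $\kappa$ with $\kappa(x)\in\mathcal{U}(x)$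 for all $x\in C_x$ such that the closed-loop system $\Sigma_\kappa:\ \dot x\in F(x,\kappa(x)),\ x\in C_x$, is safe with respect to $(X_o,X_u)$.
   Context: Set-valued map notions, for $\Phi:A\rightrightarrows\mathbb{R}^p$ with $A\subset\mathbb{R}^q$. $\Phi$ is upper semicontinuous at $x\in A$ if for each $\varepsilon>0$ there is a neighborhood $U(x)$ of $x$ with $\Phi(y)\subset\Phi(x)+\varepsilon\mathbb{B}$ for all $y\in U(x)\cap A$ ($\mathbb{B}$ is the closed unit ball). $\Phi$ is lower semicontinuous at $x\in A$ if for every open set $V$ with $\Phi(x)\cap V\neq\emptyset$ there is a neighborhood $U(x)$ of $x$ with $\Phi(z)\cap V\neq\emptyset$ for all $z\in U(x)\cap A$. Each property without reference to a point means it holds at all points of $A$. "$F$ is convex in $u$" means: $C_u$ is convex and for each $x\in C_x$, $u_1,u_2\in C_u$, $\theta\in[0,1]$, $F(x,\theta u_1+(1-\theta)u_2)\subset\theta F(x,u_1)+(1-\theta)F(x,u_2)$ (Minkowski sum). $\partial_C B(x)$ is the Clarke generalized gradient of the locally Lipschitz function $B$ at $x$. $\partial K$, $\operatorname{int}(K)$ are the boundary and interior of $K$ in $\mathbb{R}^n$. Control barrier function (CBF): a locally Lipschitz $B:\mathbb{R}^n\to\mathbb{R}$ such that $B(x)>0$ for all $x\in X_u$ and $B(x)\le 0$ for all $x\in X_o$ (barrier function candidate with respect to $(X_o,X_u)$), and such that there is an open neighborhood $U_1(\partial K)$ of $\partial K$ with $$\inf_{u\in\mathcal{U}(x)}\ \sup_{\eta\in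 F(x,u),\ \zeta\in\partial_C B(x)}\langle\zeta,\eta\rangle\le 0\qquad\forall x\in\big(U_1(\partial K)\setminus\operatorname{int}(K)\big)\cap C_x .$$ Solutions: a solution to $\dot x\in\widetilde F(x),\ x\in C_x$, is a function $x:\operatorname{dom}x\to\mathbb{R}^n$, with $\operatorname{dom}x\subset[0,\infty)$ an interval containing $0$, such that $x(0)\in\operatorname{cl}(C_x)$, $x$ is locally absolutely continuous, $x(t)\in C_x$ for all $t\in\operatorname{int}(\operatorname{dom}x)$, and $\dot x(t)\in\widetilde F(x(t))$ for almost all $t\in\operatorname{dom}x$. Safety: such a system is safe with respect to $(X_o,X_u)$ if every solution $x$ starting from a point $x(0)\in X_o$ satisfies $x(t)\in\mathbb{R}^n\setminus X_u$ for all $t\in\operatorname{dom}x$. *)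

theory Defs
  imports "HOL-Analysis.Analysis"
begin

subsection \<open>Set-valued maps\<close>

text \<open>
  A set-valued map on a set \<open>A\<close> is a total function into sets; its values outside \<open>A\<close> are
  irrelevant. Sums of sets are Minkowski sums.
\<close>

definition set_usc_on ::
  "'a::topological_space set \<Rightarrow> ('a \<Rightarrow> 'b::real_normed_vector set) \<Rightarrow> bool" where
  "set_usc_on A \<Phi> \<longleftrightarrow>
     (\<forall>x\<in>A. \<forall>\<epsilon>>0. \<exists>N. open N \<and> x \<in> N \<and>
        (\<forall>y\<in>N \<inter> A. \<Phi> y \<subseteq> \<Phi> x + (*\<^sub>R) \<epsilon> ` cball 0 1))"

definition set_lsc_on ::
  "'a::topological_space set \<Rightarrow> ('a \<Rightarrow> 'b::topological_space set) \<Rightarrow> bool" where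
  "set_lsc_on A \<Phi> \<longleftrightarrow>
     (\<forall>x\<in>A. \<forall>V. open V \<and> \<Phi> x \<inter> V \<noteq> {} \<longrightarrow>
        (\<exists>N. open N \<and> x \<in> N \<and> (\<forall>z\<in>N \<inter> A. \<Phi> z \<inter> V \<noteq> {})))"

definition convex_in_control ::
  "'a set \<Rightarrow> 'b::real_vector set \<Rightarrow> ('a \<times> 'b \<Rightarrow> 'c::real_vector set) \<Rightarrow> bool" where
  "convex_in_control Cx Cu F \<longleftrightarrow> convex Cu \<and>
     (\<forall>x\<in>Cx. \<forall>u1\<in>Cu. \<forall>u2\<in>Cu. \<forall>\<theta>\<in>{0..1}.
        F (x, \<theta> *\<^sub>R u1 + (1 - \<theta>) *\<^sub>R u2)
          \<subseteq> (*\<^sub>R) \<theta> ` F (x, u1) + (*\<^sub>R) (1 - \<theta>) ` F (x, u2))"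

subsection \<open>Clarke generalized gradient\<close>

definition locally_lipschitz :: "('a::metric_space \<Rightarrow> 'b::metric_space) \<Rightarrow> bool" where
  "locally_lipschitz f \<longleftrightarrow> (\<forall>x. \<exists>N L. open N \<and> x \<in> N \<and> L-lipschitz_on N f)"

text \<open>
  Clarke's generalized directional derivative
  \<open>f\<degree>(x; v) = limsup (f (y + t v) - f y) / t\<close> as \<open>y \<rightarrow> x\<close> and \<open>t \<down> 0\<close>; the gradient is the set
  whose support function it is. The point \<open>y = x\<close> is allowed, hence \<open>nhds\<close>.
\<close>

definition clarke_derivative :: "('a::real_normed_vector \<Rightarrow> real) \<Rightarrow> 'a \<Rightarrow> 'a \<Rightarrow> ereal" where
  "clarke_derivative f x v =
     Limsup (nhds x \<times>\<^sub>F at_right 0) (\<lambda>(y, t). ereal ((f (y + t *\<^sub>R v) - f y) / t))"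

definition clarke_gradient :: "('a::real_inner \<Rightarrow> real) \<Rightarrow> 'a \<Rightarrow> 'a set" where
  "clarke_gradient f x = {\<zeta>. \<forall>v. ereal (\<zeta> \<bullet> v) \<le> clarke_derivative f x v}"

subsection \<open>Control barrier functions\<close>

text \<open>
  The supremum is taken in the extended reals, so that it and the infimum over controls
  below are meaningful without boundedness side conditions.
\<close>

definition clarke_sup ::
  "('a::real_inner \<Rightarrow> real) \<Rightarrow> ('a \<times> 'b \<Rightarrow> 'a set) \<Rightarrow> 'a \<Rightarrow> 'b \<Rightarrow> ereal" where
  "clarke_sup B F x u =
     Sup {ereal (\<zeta> \<bullet> \<eta>) | \<zeta> \<eta>. \<zeta> \<in> clarke_gradient B x \<and> \<eta> \<in> F (x, u)}"

definition barrier_candidate :: "'a set \<Rightarrow> 'a set \<Rightarrow> ('a \<Rightarrow> real) \<Rightarrow> bool" where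
  "barrier_candidate Xo Xu B \<longleftrightarrow> (\<forall>x\<in>Xu. B x > 0) \<and> (\<forall>x\<in>Xo. B x \<le> 0)"

definition barrier_set :: "'a set \<Rightarrow> ('a \<Rightarrow> real) \<Rightarrow> 'a set" where
  "barrier_set Cx B = {x. B x \<le> 0} \<inter> Cx"

definition control_barrier_function ::
  "'a::real_inner set \<Rightarrow> ('a \<times> 'b \<Rightarrow> 'a set) \<Rightarrow> ('a \<Rightarrow> 'b set) \<Rightarrow> 'a set \<Rightarrow> 'a set
     \<Rightarrow> ('a \<Rightarrow> real) \<Rightarrow> bool" where
  "control_barrier_function Cx F \<U> Xo Xu B \<longleftrightarrow>
     locally_lipschitz B \<and> barrier_candidate Xo Xu B \<and>
     (\<exists>U1. open U1 \<and> frontier (barrier_set Cx B) \<subseteq> U1 \<and>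
        (\<forall>x\<in>(U1 - interior (barrier_set Cx B)) \<inter> Cx.
           (INF u\<in>\<U> x. clarke_sup B F x u) \<le> 0))"

subsection \<open>Solutions and safety\<close>

definition absolutely_continuous_on_interval ::
  "real \<Rightarrow> real \<Rightarrow> (real \<Rightarrow> 'a::metric_space) \<Rightarrow> bool" where
  "absolutely_continuous_on_interval a b f \<longleftrightarrow>
     (\<forall>\<epsilon>>0. \<exists>\<delta>>0. \<forall>(n::nat) l r.
        (\<forall>k<n. a \<le> l k \<and> l k \<le> r k \<and> r k \<le> b) \<and>
        disjoint_family_on (\<lambda>k. {l k<..<r k}) {..<n} \<and>
        (\<Sum>k<n. r k - l k) < \<delta>
        \<longrightarrow> (\<Sum>k<n. dist (f (l k)) (f (r k))) < \<epsilon>)"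

definition locally_absolutely_continuous_on ::
  "real set \<Rightarrow> (real \<Rightarrow> 'a::metric_space) \<Rightarrow> bool" where
  "locally_absolutely_continuous_on I f \<longleftrightarrow>
     (\<forall>a b. a \<le> b \<and> {a..b} \<subseteq> I \<longrightarrow> absolutely_continuous_on_interval a b f)"

text \<open>
  A solution is a function together with its domain \<open>I\<close>; the values of \<open>x\<close> outside \<open>I\<close> are
  irrelevant. The degenerate domain \<open>{0}\<close> is allowed.
\<close>

definition inclusion_solution ::
  "('a::real_normed_vector \<Rightarrow> 'a set) \<Rightarrow> 'a set \<Rightarrow> real set \<Rightarrow> (real \<Rightarrow> 'a) \<Rightarrow> bool" where
  "inclusion_solution G Cx I x \<longleftrightarrow>
     is_interval I \<and> 0 \<in> I \<and> I \<subseteq> {0..} \<and>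
     x 0 \<in> closure Cx \<and>
     locally_absolutely_continuous_on I x \<and>
     (\<forall>t\<in>interior I. x t \<in> Cx) \<and>
     (AE t in lebesgue. t \<in> I \<longrightarrow> (\<exists>v\<in>G (x t). (x has_vector_derivative v) (at t within I)))"

definition safe_inclusion ::
  "('a::real_normed_vector \<Rightarrow> 'a set) \<Rightarrow> 'a set \<Rightarrow> 'a set \<Rightarrow> 'a set \<Rightarrow> bool" where
  "safe_inclusion G Cx Xo Xu \<longleftrightarrow>
     (\<forall>I x. inclusion_solution G Cx I x \<and> x 0 \<in> Xo \<longrightarrow> (\<forall>t\<in>I. x t \<in> - Xu))"

end

theory Submission
  imports Defs
begin

text \<open>
  Write \<open>g x u = clarke_sup B F x u\<close> and \<open>K = barrier_set Cx B\<close>.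

  Safety of a closed loop needs \<open>g x (\<kappa> x) < 0\<close> only close to \<open>frontier K\<close> and outside
  \<open>interior K\<close>. A trajectory from \<open>Xo\<close> to \<open>Xu\<close> would have a last time in \<open>K\<close>, and just after it
  would run through that region with \<open>B > 0\<close>. There every velocity \<open>v\<close> has negative Clarke
  derivative, because the derivative in direction \<open>v\<close> is attained as \<open>\<zeta> \<bullet> v\<close> for some Clarke gradient
  \<open>\<zeta>\<close> (\<open>clarke_derivative_attained\<close>), so \<open>B\<close> locally decreases along the curve at almost every
  time (\<open>decreasing_along_curve\<close>). Absolute continuity turns this into \<open>B\<close> being nonincreasing
  (\<open>absolutely_continuous_nonincreasing\<close>), so it cannot leave the value \<open>\<le> 0\<close> that it had in \<open>K\<close>.

  It remains to find a continuous selection \<open>\<kappa>\<close> of \<open>\<U>\<close> with \<open>g x (\<kappa> x) < 0\<close> on a closed set \<open>T\<close>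
  containing that region. The set \<open>{u \<in> \<U> x. g x u < 0}\<close> is convex, since \<open>F\<close> is convex in \<open>u\<close>, but
  in general it is not closed. Its closure may contain points with \<open>g x u > 0\<close>, since \<open>g\<close> is only
  upper semicontinuous, so Michael's theorem cannot simply be applied to the closures. Upper
  semicontinuity does make \<open>g < 0\<close> an open condition on \<open>(x, u)\<close> (\<open>open_decreasing_controls\<close>).
  Hence a continuous selection of \<open>\<U>\<close> through one decreasing control, as given by
  \<open>michael_selection_through_point\<close>, consists of decreasing controls nearby, and by convexity these
  local choices can be averaged by a partition of unity (\<open>glue_local_selections\<close>).
\<close>

section \<open>Continuous selections\<close>

text \<open>
  Convex combinations with the weights of a partition of unity stay in a convex value, so the
  existence of a continuous selection of a convex-valued map is a local question.
\<close>

lemma glue_local_selections: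
  fixes S :: "'a::{metric_space,second_countable_topology} set"
    and \<Phi> :: "'a \<Rightarrow> 'b::real_normed_vector set"
  assumes convex: "\<And>x. x \<in> S \<Longrightarrow> convex (\<Phi> x)"
    and local: "\<And>x. x \<in> S \<Longrightarrow>
      \<exists>N f. open N \<and> x \<in> N \<and> continuous_on S f \<and> (\<forall>y\<in>S \<inter> N. f y \<in> \<Phi> y)"
  obtains f where "continuous_on S f" "\<And>x. x \<in> S \<Longrightarrow> f x \<in> \<Phi> x"
proof -
  define \<C>0 where
    "\<C>0 = {N. open N \<and> (\<exists>f. continuous_on S f \<and> (\<forall>y\<in>S \<inter> N. f y \<in> \<Phi> y))}"
  have "S \<subseteq> \<Union>\<C>0"
    using local unfolding \<C>0_def by blast
  moreover have "open N" if "N \<in> \<C>0" for N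
    using that by (simp add: \<C>0_def)
  ultimately obtain \<C> where cover: "S \<subseteq> \<Union>\<C>"
    and refine: "\<And>U. U \<in> \<C> \<Longrightarrow> open U \<and> (\<exists>N. N \<in> \<C>0 \<and> U \<subseteq> N)"
    and fin: "\<And>x. x \<in> S \<Longrightarrow> \<exists>V. open V \<and> x \<in> V \<and> finite {U \<in> \<C>. U \<inter> V \<noteq> {}}"
    by (rule paracompact) blast+
  have "\<exists>f. continuous_on S f \<and> (\<forall>y\<in>S \<inter> U. f y \<in> \<Phi> y)" if "U \<in> \<C>" for U
    using refine[OF that] unfolding \<C>0_def by blast
  then obtain s where cont_s: "\<And>U. U \<in> \<C> \<Longrightarrow> continuous_on S (s U)"
    and sel_s: "\<And>U y. U \<in> \<C> \<Longrightarrow> y \<in> S \<Longrightarrow> y \<in> U \<Longrightarrow> s U y \<in> \<Phi> y"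
    by (metis IntI)
  have "\<exists>\<rho> :: 'a set \<Rightarrow> 'a \<Rightarrow> real. (\<forall>U\<in>\<C>. continuous_on S (\<rho> U) \<and> (\<forall>x \<in> S. 0 \<le> \<rho> U x))
      \<and> (\<forall>x U. U \<in> \<C> \<longrightarrow> x \<in> S \<longrightarrow> x \<notin> U \<longrightarrow> \<rho> U x = 0)
      \<and> (\<forall>x\<in>S. supp_sum (\<lambda>W. \<rho> W x) \<C> = 1)"
    using refine by (rule_tac subordinate_partition_of_unity[OF cover _ fin]) blast+
  then obtain \<rho> :: "'a set \<Rightarrow> 'a \<Rightarrow> real"
    where cont_\<rho>: "\<And>U. U \<in> \<C> \<Longrightarrow> continuous_on S (\<rho> U)"
      and \<rho>_nonneg: "\<And>U x. U \<in> \<C> \<Longrightarrow> x \<in> S \<Longrightarrow> 0 \<le> \<rho> U x"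
      and \<rho>_zero: "\<And>x U. U \<in> \<C> \<Longrightarrow> x \<in> S \<Longrightarrow> x \<notin> U \<Longrightarrow> \<rho> U x = 0"
      and \<rho>_sum: "\<And>x. x \<in> S \<Longrightarrow> supp_sum (\<lambda>W. \<rho> W x) \<C> = 1"
    by blast
  define f where "f x = (\<Sum>U | U \<in> \<C> \<and> x \<in> U. \<rho> U x *\<^sub>R s U x)" for x
  show thesis
  proof
    fix x assume x: "x \<in> S"
    have finx: "finite {U \<in> \<C>. x \<in> U}"
    proof -
      obtain V where "x \<in> V" "finite {U \<in> \<C>. U \<inter> V \<noteq> {}}"
        using fin[OF x] by blast
      then show ?thesis
        by (elim finite_subset[rotated]) auto
    qed
    have "(\<Sum>U | U \<in> \<C> \<and> x \<in> U. \<rho> U x) = supp_sum (\<lambda>W. \<rho> W x) \<C>"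
      unfolding supp_sum_def support_on_def
      by (rule sum.mono_neutral_right[OF finx]) (use \<rho>_zero x in auto)
    then show "f x \<in> \<Phi> x"
      unfolding f_def using \<rho>_sum[OF x] \<rho>_nonneg sel_s x
      by (intro convex_sum[OF finx convex[OF x]]) auto
  next
    show "continuous_on S f"
      unfolding continuous_on_eq_continuous_within
    proof
      fix x assume x: "x \<in> S"
      obtain V where V: "open V" "x \<in> V" and finV: "finite {U \<in> \<C>. U \<inter> V \<noteq> {}}"
        using fin[OF x] by blast
      have eq: "(\<Sum>U | U \<in> \<C> \<and> U \<inter> V \<noteq> {}. \<rho> U y *\<^sub>R s U y) = f y" if "y \<in> S \<inter> V" for y
        unfolding f_def
        by (rule sum.mono_neutral_right[OF finV]) (use that \<rho>_zero in auto)
      have "continuous_on S (\<lambda>y. \<Sum>U | U \<in> \<C> \<and> U \<inter> V \<noteq> {}. \<rho> U y *\<^sub>R s U y)"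
        by (intro continuous_on_sum continuous_on_scaleR) (auto intro: cont_\<rho> cont_s)
      then have "continuous (at x within S) (\<lambda>y. \<Sum>U | U \<in> \<C> \<and> U \<inter> V \<noteq> {}. \<rho> U y *\<^sub>R s U y)"
        using x by (simp add: continuous_on_eq_continuous_within)
      then show "continuous (at x within S) f"
        by (rule continuous_transform_within_openin[where S = "S \<inter> V"])
          (use V x eq in \<open>auto simp: openin_open_Int\<close>)
    qed
  qed
qed

lemma convex_plus_ball:
  fixes A :: "'a::real_normed_vector set"
  assumes "convex A"
  shows "convex {y. \<exists>z\<in>A. dist y z < \<epsilon>}"
proof -
  have "{y. \<exists>z\<in>A. dist y z < \<epsilon>} = (\<Union>z\<in>A. \<Union>w\<in>ball 0 \<epsilon>. {z + w})" (is "?L = ?R")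
  proof
    show "?L \<subseteq> ?R"
    proof
      fix y assume "y \<in> ?L"
      then obtain z where "z \<in> A" "dist y z < \<epsilon>" by blast
      then show "y \<in> ?R"
        by (intro UN_I[of z] UN_I[of "y - z"]) (auto simp: dist_norm norm_minus_commute)
    qed
    show "?R \<subseteq> ?L"
    proof clarify
      fix z w :: 'a assume "z \<in> A" "w \<in> ball 0 \<epsilon>"
      then have "dist (z + w) z < \<epsilon>" by (simp add: dist_norm)
      with \<open>z \<in> A\<close> show "\<exists>z'\<in>A. dist (z + w) z' < \<epsilon>" by blast
    qed
  qed
  then show ?thesis
    using convex_sums[OF assms convex_ball[of 0 \<epsilon>]] by auto
qed

text \<open>
  One step of Michael's iteration: intersecting with the \<open>2 * \<epsilon>\<close>-ball around \<open>f x\<close> keeps the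
  next approximation close to the previous one. Locally a constant is good enough: a point
  \<open>z \<in> \<Phi> x\<close> close to \<open>f x\<close> stays within \<open>\<epsilon> / 2\<close> of \<open>\<Phi> y\<close> by lower semicontinuity.
\<close>

lemma improve_approximate_selection:
  fixes S :: "'a::{metric_space,second_countable_topology} set"
    and \<Phi> :: "'a \<Rightarrow> 'b::real_normed_vector set"
  assumes lsc: "set_lsc_on S \<Phi>" and convex: "\<And>x. x \<in> S \<Longrightarrow> convex (\<Phi> x)"
    and "\<epsilon> > 0" and f: "continuous_on S f" "\<And>x. x \<in> S \<Longrightarrow> \<exists>z\<in>\<Phi> x. dist (f x) z < \<epsilon>"
  obtains g where "continuous_on S g" "\<And>x. x \<in> S \<Longrightarrow> \<exists>z\<in>\<Phi> x. dist (g x) z < \<epsilon> / 2"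
    "\<And>x. x \<in> S \<Longrightarrow> dist (f x) (g x) < 2 * \<epsilon>"
proof (rule glue_local_selections
    [where S = S and \<Phi> = "\<lambda>x. {y. \<exists>z\<in>\<Phi> x. dist y z < \<epsilon> / 2} \<inter> ball (f x) (2 * \<epsilon>)"])
  show "convex ({y. \<exists>z\<in>\<Phi> x. dist y z < \<epsilon> / 2} \<inter> ball (f x) (2 * \<epsilon>))" if "x \<in> S" for x
    by (intro convex_Int convex_plus_ball convex that convex_ball)
next
  fix x assume x: "x \<in> S"
  obtain z where z: "z \<in> \<Phi> x" "dist (f x) z < \<epsilon>"
    using f(2)[OF x] by blast
  have "\<Phi> x \<inter> ball z (\<epsilon> / 2) \<noteq> {}"
    using z \<open>\<epsilon> > 0\<close> by force
  then obtain N where N: "open N" "x \<in> N" "\<And>y. y \<in> N \<inter> S \<Longrightarrow> \<Phi> y \<inter> ball z (\<epsilon> / 2) \<noteq> {}"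
    using lsc x unfolding set_lsc_on_def by (metis open_ball)
  obtain M where M: "open M" "x \<in> M" "\<And>y. y \<in> S \<Longrightarrow> y \<in> M \<Longrightarrow> f y \<in> ball (f x) \<epsilon>"
    using f(1) x \<open>\<epsilon> > 0\<close> unfolding continuous_on_topological
    by (metis centre_in_ball open_ball)
  show "\<exists>N h. open N \<and> x \<in> N \<and> continuous_on S h \<and>
      (\<forall>y\<in>S \<inter> N. h y \<in> {w. \<exists>z\<in>\<Phi> y. dist w z < \<epsilon> / 2} \<inter> ball (f y) (2 * \<epsilon>))"
  proof (intro exI conjI ballI)
    show "open (N \<inter> M)" "x \<in> N \<inter> M" "continuous_on S (\<lambda>_. z)"
      using N M by auto
    fix y assume y: "y \<in> S \<inter> (N \<inter> M)"
    have "dist (f y) z < 2 * \<epsilon>"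
      using M(3)[of y] y z(2) dist_triangle[of "f y" z "f x"] by (auto simp: dist_commute)
    then show "z \<in> {w. \<exists>z\<in>\<Phi> y. dist w z < \<epsilon> / 2} \<inter> ball (f y) (2 * \<epsilon>)"
      using N(3)[of y] y by auto
  qed
qed (use that in auto)

text \<open>
  Successive approximations with errors \<open>(1/2) ^ n\<close> converge uniformly because each is chosen
  close to its predecessor; the limit has distance 0 from each value, which is closed.
\<close>

theorem michael_selection:
  fixes S :: "'a::{metric_space,second_countable_topology} set"
    and \<Phi> :: "'a \<Rightarrow> 'b::banach set"
  assumes lsc: "set_lsc_on S \<Phi>"
    and vals: "\<And>x. x \<in> S \<Longrightarrow> \<Phi> x \<noteq> {} \<and> closed (\<Phi> x) \<and> convex (\<Phi> x)"
  obtains f where "continuous_on S f" "\<And>x. x \<in> S \<Longrightarrow> f x \<in> \<Phi> x"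
proof -
  define P where "P n f \<longleftrightarrow> continuous_on S f \<and> (\<forall>x\<in>S. \<exists>z\<in>\<Phi> x. dist (f x) z < (1/2) ^ n)"
    for n :: nat and f
  define Q where "Q n f g \<longleftrightarrow> (\<forall>x\<in>S. dist (f x) (g x) < 2 * (1/2) ^ n)"
    for n :: nat and f g :: "'a \<Rightarrow> 'b"
  have "\<exists>f. P 0 f"
  proof (rule glue_local_selections[where S = S and \<Phi> = "\<lambda>x. {y. \<exists>z\<in>\<Phi> x. dist y z < 1}"])
    show "convex {y. \<exists>z\<in>\<Phi> x. dist y z < 1}" if "x \<in> S" for x
      using vals that by (intro convex_plus_ball) auto
  next
    fix x assume x: "x \<in> S"
    obtain z where z: "z \<in> \<Phi> x"
      using vals x by blast
    then have "\<Phi> x \<inter> ball z 1 \<noteq> {}" by force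
    then obtain N where "open N" "x \<in> N" "\<And>y. y \<in> N \<inter> S \<Longrightarrow> \<Phi> y \<inter> ball z 1 \<noteq> {}"
      using lsc x unfolding set_lsc_on_def by (metis open_ball)
    then show "\<exists>N h. open N \<and> x \<in> N \<and> continuous_on S h \<and>
        (\<forall>y\<in>S \<inter> N. h y \<in> {w. \<exists>z\<in>\<Phi> y. dist w z < 1})"
      by (intro exI[of _ N] exI[of _ "\<lambda>_. z"]) (fastforce simp: dist_commute)
  next
    show "\<exists>f. P 0 f" if "continuous_on S f" "\<And>x. x \<in> S \<Longrightarrow> f x \<in> {y. \<exists>z\<in>\<Phi> x. dist y z < 1}" for f
      using that unfolding P_def by auto
  qed
  moreover have "\<exists>g. P (Suc n) g \<and> Q n f g" if "P n f" for f n
    using that unfolding P_def Q_def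
    by (elim conjE, rule_tac improve_approximate_selection[OF lsc, of "(1/2)^n" f])
      (use vals in \<open>auto simp: field_simps\<close>)
  ultimately obtain f where P: "\<And>n. P n (f n)" and Q: "\<And>n. Q n (f n) (f (Suc n))"
    using dependent_nat_choice[of P Q] by blast
  (* Telescoping lets the Weierstrass M-test supply the uniform limit. *)
  define d where "d n x = f (Suc n) x - f n x" for n x
  have "uniform_limit S (\<lambda>n x. \<Sum>i<n. d i x) (\<lambda>x. \<Sum>i. d i x) sequentially"
  proof (rule Weierstrass_m_test)
    show "norm (d n x) \<le> 2 * (1/2) ^ n" if "x \<in> S" for n x
      using Q[of n] that unfolding Q_def d_def by (force simp: dist_norm norm_minus_commute)
  qed (simp add: summable_mult)
  moreover have "(\<Sum>i<n. d i x) = f n x - f 0 x" for n x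
    unfolding d_def by (rule sum_lessThan_telescope)
  ultimately have lim: "uniform_limit S (\<lambda>n x. f n x - f 0 x) (\<lambda>x. \<Sum>i. d i x) sequentially"
    by simp
  define F where "F x = f 0 x + (\<Sum>i. d i x)" for x
  have cont: "continuous_on S (f n)" for n
    using P[of n] by (simp add: P_def)
  have "continuous_on S (\<lambda>x. \<Sum>i. d i x)"
    by (rule uniform_limit_theorem[OF _ lim]) (auto intro!: always_eventually continuous_intros cont)
  then have "continuous_on S F"
    unfolding F_def by (intro continuous_intros cont)
  moreover have "F x \<in> \<Phi> x" if x: "x \<in> S" for x
  proof -
    have "(\<lambda>n. f n x - f 0 x) \<longlonglongrightarrow> (\<Sum>i. d i x)"
      by (rule tendsto_uniform_limitI[OF lim x])
    then have "(\<lambda>n. f 0 x + (f n x - f 0 x)) \<longlonglongrightarrow> F x"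
      unfolding F_def by (intro tendsto_intros)
    then have fx: "(\<lambda>n. f n x) \<longlonglongrightarrow> F x" by simp
    have "\<forall>n. \<exists>z. z \<in> \<Phi> x \<and> dist (f n x) z < (1/2) ^ n"
      using P x unfolding P_def by blast
    then obtain z where z: "\<And>n. z n \<in> \<Phi> x" "\<And>n. dist (f n x) (z n) < (1/2) ^ n"
      by metis
    have "(\<lambda>n. dist (f n x) (z n)) \<longlonglongrightarrow> 0"
      by (rule tendsto_sandwich[of "\<lambda>_. 0" _ _ "\<lambda>n. (1/2) ^ n"])
        (use z(2) in \<open>auto intro!: always_eventually less_imp_le LIMSEQ_power_zero\<close>)
    then have "(\<lambda>n. norm (z n - f n x)) \<longlonglongrightarrow> 0"
      by (simp add: dist_norm norm_minus_commute)
    then have "z \<longlonglongrightarrow> F x"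
      by (rule Lim_transform[OF fx tendsto_norm_zero_cancel])
    then show ?thesis
      using closed_sequentially[of "\<Phi> x" z] vals[OF x] z(1) by blast
  qed
  ultimately show thesis by (rule that)
qed

text \<open>
  Shrinking the value at a single point to a singleton preserves lower semicontinuity, so the
  selection may be required to pass through a given point of the graph.
\<close>

corollary michael_selection_through_point:
  fixes S :: "'a::{metric_space,second_countable_topology} set"
    and \<Phi> :: "'a \<Rightarrow> 'b::banach set"
  assumes lsc: "set_lsc_on S \<Phi>"
    and vals: "\<And>x. x \<in> S \<Longrightarrow> \<Phi> x \<noteq> {} \<and> closed (\<Phi> x) \<and> convex (\<Phi> x)"
    and x0: "x0 \<in> S" and u0: "u0 \<in> \<Phi> x0"
  obtains f where "continuous_on S f" "\<And>x. x \<in> S \<Longrightarrow> f x \<in> \<Phi> x" "f x0 = u0"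
proof -
  define \<Psi> where "\<Psi> = \<Phi>(x0 := {u0})"
  have "set_lsc_on S \<Psi>"
    unfolding set_lsc_on_def
  proof (intro ballI allI impI)
    fix x V assume x: "x \<in> S" and V: "open V \<and> \<Psi> x \<inter> V \<noteq> {}"
    then have "\<Phi> x \<inter> V \<noteq> {}"
      using u0 by (auto simp: \<Psi>_def split: if_splits)
    then obtain N where N: "open N" "x \<in> N" "\<forall>z\<in>N \<inter> S. \<Phi> z \<inter> V \<noteq> {}"
      using lsc x V unfolding set_lsc_on_def by blast
    show "\<exists>N. open N \<and> x \<in> N \<and> (\<forall>z\<in>N \<inter> S. \<Psi> z \<inter> V \<noteq> {})"
    proof (cases "x = x0")
      case True
      then show ?thesis
        using N V by (intro exI[of _ N]) (auto simp: \<Psi>_def)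
    next
      case False
      then show ?thesis
        using N by (intro exI[of _ "N - {x0}"]) (auto simp: \<Psi>_def open_delete)
    qed
  qed
  moreover have "\<Psi> x \<noteq> {} \<and> closed (\<Psi> x) \<and> convex (\<Psi> x)" if "x \<in> S" for x
    using vals[OF that] by (simp add: \<Psi>_def)
  ultimately obtain f where "continuous_on S f" "\<And>x. x \<in> S \<Longrightarrow> f x \<in> \<Psi> x"
    using michael_selection by blast
  then show thesis
    using that[of f] x0 u0 by (force simp: \<Psi>_def split: if_splits)
qed

section \<open>The Clarke gradient\<close>

lemma clarke_derivative_lessD:
  assumes "clarke_derivative f x v < c"
  obtains \<delta> where "\<delta> > 0"
    "\<And>y t. dist y x < \<delta> \<Longrightarrow> 0 < t \<Longrightarrow> t < \<delta> \<Longrightarrow> ereal ((f (y + t *\<^sub>R v) - f y) / t) < c"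
proof -
  have "\<forall>\<^sub>F (y, t) in nhds x \<times>\<^sub>F at_right 0. ereal ((f (y + t *\<^sub>R v) - f y) / t) < c"
    using Limsup_lessD[OF assms[unfolded clarke_derivative_def]]
    by (simp add: case_prod_unfold)
  then obtain P Q where "eventually P (nhds x)" "eventually Q (at_right (0::real))"
    and PQ: "\<And>y t. P y \<Longrightarrow> Q t \<Longrightarrow> ereal ((f (y + t *\<^sub>R v) - f y) / t) < c"
    unfolding eventually_prod_filter by auto
  then obtain d b where "d > 0" "\<And>y. dist y x < d \<Longrightarrow> P y"
    and "b > 0" "\<And>t. 0 < t \<Longrightarrow> t < b \<Longrightarrow> Q t"
    unfolding eventually_nhds_metric eventually_at_right[OF zero_less_one] by blast
  with PQ show thesis
    by (intro that[of "min d b"]) auto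
qed

lemma clarke_derivative_leI:
  assumes "\<delta> > 0"
    and le: "\<And>y t. dist y x < \<delta> \<Longrightarrow> 0 < t \<Longrightarrow> t < \<delta> \<Longrightarrow> ereal ((f (y + t *\<^sub>R v) - f y) / t) \<le> c"
  shows "clarke_derivative f x v \<le> c"
  unfolding clarke_derivative_def
proof (rule Limsup_bounded)
  have "\<forall>\<^sub>F y in nhds x. dist y x < \<delta>" "\<forall>\<^sub>F t in at_right (0::real). 0 < t \<and> t < \<delta>"
    using \<open>\<delta> > 0\<close> unfolding eventually_nhds_metric eventually_at_right[OF zero_less_one] by auto
  then show "\<forall>\<^sub>F z in nhds x \<times>\<^sub>F at_right 0.
      (case z of (y, t) \<Rightarrow> ereal ((f (y + t *\<^sub>R v) - f y) / t)) \<le> c"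
    unfolding eventually_prod_filter using le by fast
qed

lemma clarke_derivative_usc:
  assumes "clarke_derivative f x v < c"
  shows "\<forall>\<^sub>F y in nhds x. clarke_derivative f y v \<le> c"
proof -
  obtain \<delta> where \<delta>: "\<delta> > 0"
    "\<And>y t. dist y x < \<delta> \<Longrightarrow> 0 < t \<Longrightarrow> t < \<delta> \<Longrightarrow> ereal ((f (y + t *\<^sub>R v) - f y) / t) < c"
    using clarke_derivative_lessD[OF assms] by blast
  have "clarke_derivative f y v \<le> c" if "dist y x < \<delta> / 2" for y
  proof (rule clarke_derivative_leI)
    show "ereal ((f (z + t *\<^sub>R v) - f z) / t) \<le> c" if "dist z y < \<delta> / 2" "0 < t" "t < \<delta> / 2" for z t
    proof -
      have "dist z x < \<delta>"
        using that \<open>dist y x < \<delta> / 2\<close> dist_triangle[of z x y] by linarith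
      with \<delta>(2)[of z t] that \<open>\<delta> > 0\<close> show ?thesis by auto
    qed
  qed (use \<delta>(1) in auto)
  then show ?thesis
    using \<open>\<delta> > 0\<close> unfolding eventually_nhds_metric by (intro exI[of _ "\<delta> / 2"]) auto
qed

lemma clarke_derivative_abs_le:
  assumes lip: "L-lipschitz_on N f" and N: "open N" "x \<in> N"
  shows "\<bar>clarke_derivative f x v\<bar> \<le> ereal (L * norm v)"
proof -
  obtain e where e: "e > 0" "ball x e \<subseteq> N"
    using N openE by blast
  define \<delta> where "\<delta> = e / 2 / (1 + norm v)"
  have nv: "1 + norm v > 0"
    using norm_ge_zero[of v] by linarith
  then have "\<delta> > 0"
    using e by (simp add: \<delta>_def)
  have bound: "\<bar>(f (y + t *\<^sub>R v) - f y) / t\<bar> \<le> L * norm v"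
    if "dist y x < \<delta>" "0 < t" "t < \<delta>" for y t
  proof -
    have "dist (y + t *\<^sub>R v) x \<le> dist y x + t * norm v"
      using dist_triangle[of "y + t *\<^sub>R v" x y] that by (simp add: dist_norm)
    also have "\<dots> < \<delta> + \<delta> * norm v"
      using that by (intro add_less_le_mono mult_right_mono) auto
    also have "\<dots> = \<delta> * (1 + norm v)"
      by (simp add: algebra_simps)
    also have "\<dots> = e / 2"
      by (subst nonzero_eq_divide_eq[symmetric]) (use nv in \<open>auto simp: \<delta>_def\<close>)
    finally have "y + t *\<^sub>R v \<in> N"
      using e by (auto simp: dist_commute)
    moreover have "\<delta> \<le> e / 2"
      using e nv by (simp add: \<delta>_def field_simps)
    then have "y \<in> N"
      using e that by (force simp: dist_commute)
    ultimately have "\<bar>f (y + t *\<^sub>R v) - f y\<bar> \<le> L * (t * norm v)"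
      using lipschitz_onD[OF lip, of "y + t *\<^sub>R v" y] that by (simp add: dist_norm)
    then show ?thesis
      using that by (simp add: field_simps)
  qed
  have "clarke_derivative f x v \<le> ereal (L * norm v)"
    by (rule clarke_derivative_leI[OF \<open>\<delta> > 0\<close>]) (simp add: abs_le_D1[OF bound])
  moreover have "ereal (- (L * norm v)) \<le> clarke_derivative f x v"
  proof (rule ccontr)
    assume "\<not> ?thesis"
    then obtain d where d: "d > 0" "\<And>y t. dist y x < d \<Longrightarrow> 0 < t \<Longrightarrow> t < d \<Longrightarrow>
        ereal ((f (y + t *\<^sub>R v) - f y) / t) < ereal (- (L * norm v))"
      using clarke_derivative_lessD[of f x v] by (metis not_le)
    define t where "t = min \<delta> d / 2"
    have "t > 0" "t < \<delta>" "t < d"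
      using d \<open>\<delta> > 0\<close> by (auto simp: t_def)
    then have "(f (x + t *\<^sub>R v) - f x) / t < - (L * norm v)"
      using d(2)[of x t] d(1) by simp
    moreover have "\<bar>(f (x + t *\<^sub>R v) - f x) / t\<bar> \<le> L * norm v"
      using bound[of x t] \<open>t > 0\<close> \<open>t < \<delta>\<close> \<open>\<delta> > 0\<close> by simp
    ultimately show False by linarith
  qed
  ultimately show ?thesis
    by (cases "clarke_derivative f x v") auto
qed

lemma clarke_derivative_scaleR:
  assumes "s > 0"
  shows "clarke_derivative f x (s *\<^sub>R v) \<le> ereal s * clarke_derivative f x v"
proof (rule dense_ge)
  fix c assume "ereal s * clarke_derivative f x v < c"
  then have "clarke_derivative f x v < c / ereal s"
    using assms by (simp add: ereal_less_divide_pos mult.commute)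
  then obtain \<delta> where \<delta>: "\<delta> > 0" "\<And>y t. dist y x < \<delta> \<Longrightarrow> 0 < t \<Longrightarrow> t < \<delta> \<Longrightarrow>
      ereal ((f (y + t *\<^sub>R v) - f y) / t) < c / ereal s"
    using clarke_derivative_lessD by blast
  show "clarke_derivative f x (s *\<^sub>R v) \<le> c"
  proof (rule clarke_derivative_leI[of "min \<delta> (\<delta> / s)"])
    fix y t assume t: "dist y x < min \<delta> (\<delta> / s)" "0 < t" "t < min \<delta> (\<delta> / s)"
    then have "ereal ((f (y + (t * s) *\<^sub>R v) - f y) / (t * s)) < c / ereal s"
      using assms by (intro \<delta>) (auto simp: field_simps)
    then have "ereal s * ereal ((f (y + (t * s) *\<^sub>R v) - f y) / (t * s)) < c"
      using assms by (simp add: ereal_less_divide_pos mult.commute)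
    then show "ereal ((f (y + t *\<^sub>R s *\<^sub>R v) - f y) / t) \<le> c"
      using assms by (simp add: less_imp_le)
  qed (use \<delta> assms in auto)
qed

text \<open>
  Letting the base point \<open>y\<close> vary in the definition is what makes the derivative subadditive:
  the increment in direction \<open>v + w\<close> splits at the nearby point \<open>y + t *\<^sub>R v\<close>.
\<close>

lemma clarke_derivative_add_less:
  assumes v: "clarke_derivative f x v < ereal a" and w: "clarke_derivative f x w < ereal b"
  shows "clarke_derivative f x (v + w) \<le> ereal (a + b)"
proof -
  obtain d1 where d1: "d1 > 0" "\<And>y t. dist y x < d1 \<Longrightarrow> 0 < t \<Longrightarrow> t < d1 \<Longrightarrow>
      ereal ((f (y + t *\<^sub>R v) - f y) / t) < ereal a"
    using clarke_derivative_lessD[OF v] by blast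
  obtain d2 where d2: "d2 > 0" "\<And>y t. dist y x < d2 \<Longrightarrow> 0 < t \<Longrightarrow> t < d2 \<Longrightarrow>
      ereal ((f (y + t *\<^sub>R w) - f y) / t) < ereal b"
    using clarke_derivative_lessD[OF w] by blast
  have nv: "1 + norm v > 0"
    using norm_ge_zero[of v] by linarith
  define \<delta> where "\<delta> = min d1 (d2 / (1 + norm v))"
  show ?thesis
  proof (rule clarke_derivative_leI)
    show "\<delta> > 0"
      using d1 d2 nv by (simp add: \<delta>_def)
    fix y t assume t: "dist y x < \<delta>" "0 < t" "t < \<delta>"
    have \<delta>d2: "\<delta> + \<delta> * norm v \<le> d2"
    proof -
      have "\<delta> * (1 + norm v) \<le> d2 / (1 + norm v) * (1 + norm v)"
        using nv by (intro mult_right_mono) (auto simp: \<delta>_def)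
      also have "\<dots> = d2"
        using nv by simp
      finally show ?thesis
        by (simp add: algebra_simps)
    qed
    have "dist (y + t *\<^sub>R v) x \<le> dist y x + t * norm v"
      using dist_triangle[of "y + t *\<^sub>R v" x y] t by (simp add: dist_norm)
    also have "\<dots> < \<delta> + \<delta> * norm v"
      using t by (intro add_less_le_mono mult_right_mono) auto
    finally have "dist (y + t *\<^sub>R v) x < d2"
      using \<delta>d2 by linarith
    moreover have "t < d2"
      using \<delta>d2 t mult_nonneg_nonneg[of \<delta> "norm v"] by (smt (verit) norm_ge_zero)
    ultimately have "(f ((y + t *\<^sub>R v) + t *\<^sub>R w) - f (y + t *\<^sub>R v)) / t < b"
      using d2(2) t by simp
    moreover have "(f (y + t *\<^sub>R v) - f y) / t < a"
      using d1(2)[of y t] t by (simp add: \<delta>_def)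
    ultimately have "(f (y + t *\<^sub>R (v + w)) - f y) / t \<le> a + b"
      by (simp add: diff_divide_distrib scaleR_add_right add.assoc)
    then show "ereal ((f (y + t *\<^sub>R (v + w)) - f y) / t) \<le> ereal (a + b)"
      by simp
  qed
qed

text \<open>
  Separating the point \<open>(v, p v)\<close> from the strict epigraph of \<open>p\<close> produces a subgradient at
  \<open>v\<close>; homogeneity of \<open>p\<close> turns it into a minorant that is exact at \<open>v\<close>.
\<close>

lemma sublinear_attained_by_inner:
  fixes p :: "'a::euclidean_space \<Rightarrow> real"
  assumes add: "\<And>x y. p (x + y) \<le> p x + p y"
    and scale: "\<And>s x. s > 0 \<Longrightarrow> p (s *\<^sub>R x) \<le> s * p x"
  obtains \<zeta> where "\<And>w. \<zeta> \<bullet> w \<le> p w" "p v \<le> \<zeta> \<bullet> v"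
proof -
  define E where "E = {(y, r). p y < r}"
  have "convex E"
    unfolding convex_def
  proof (intro ballI allI impI)
    fix X Y and s t :: real
    assume "X \<in> E" "Y \<in> E" and st: "0 \<le> s" "0 \<le> t" "s + t = 1"
    then obtain y q z r where XY: "X = (y, q)" "Y = (z, r)" "p y < q" "p z < r"
      by (auto simp: E_def)
    have "p (s *\<^sub>R y + t *\<^sub>R z) < s * q + t * r"
    proof (cases "s = 0 \<or> t = 0")
      case True
      with st XY show ?thesis by auto
    next
      case False
      then have "s > 0" "t > 0" using st by auto
      have "p (s *\<^sub>R y + t *\<^sub>R z) \<le> s * p y + t * p z"
        using add[of "s *\<^sub>R y" "t *\<^sub>R z"] scale[OF \<open>s > 0\<close>, of y] scale[OF \<open>t > 0\<close>, of z]
        by linarith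
      also have "\<dots> < s * q + t * r"
        using XY \<open>s > 0\<close> \<open>t > 0\<close> by (intro add_strict_mono) auto
      finally show ?thesis .
    qed
    then show "s *\<^sub>R X + t *\<^sub>R Y \<in> E"
      by (simp add: XY E_def)
  qed
  moreover have "(v, p v + 1) \<in> E" "{(v, p v)} \<inter> E = {}"
    by (auto simp: E_def)
  ultimately obtain A b where A: "A \<noteq> 0" "A \<bullet> (v, p v) \<le> b" "\<And>z. z \<in> E \<Longrightarrow> b \<le> A \<bullet> z"
    using separating_hyperplane_sets[OF convex_singleton[of "(v, p v)"], of E] by blast
  obtain a \<alpha> where A_eq: "A = (a, \<alpha>)" by (cases A)
  have sep: "a \<bullet> v + \<alpha> * p v \<le> a \<bullet> y + \<alpha> * r" if "p y < r" for y r
    using A(2) A(3)[of "(y, r)"] that by (auto simp: A_eq E_def inner_Pair)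
  have "\<alpha> \<ge> 0"
    using sep[of v "p v + 1"] by (simp add: algebra_simps)
  moreover have "\<alpha> \<noteq> 0"
  proof
    assume "\<alpha> = 0"
    then have "a \<bullet> v \<le> a \<bullet> (v - a)"
      using sep[of "v - a" "p (v - a) + 1"] by simp
    then have "a \<bullet> a \<le> 0"
      by (simp add: inner_diff_right)
    then have "a = 0"
      using inner_ge_zero[of a] by (metis antisym inner_eq_zero_iff)
    with A(1) \<open>\<alpha> = 0\<close> show False
      by (simp add: A_eq zero_prod_def)
  qed
  (* The separating hyperplane is not vertical, so it is the graph of an affine minorant of p. *)
  ultimately have "\<alpha> > 0" by simp
  define \<zeta> where "\<zeta> = - (1 / \<alpha>) *\<^sub>R a"
  have sub: "p v + \<zeta> \<bullet> (y - v) \<le> p y" for y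
  proof (rule field_le_epsilon)
    fix e :: real assume "e > 0"
    then have "a \<bullet> v + \<alpha> * p v \<le> a \<bullet> y + \<alpha> * (p y + e)"
      by (intro sep) simp
    then show "p v + \<zeta> \<bullet> (y - v) \<le> p y + e"
      using \<open>\<alpha> > 0\<close> by (simp add: \<zeta>_def inner_diff_right field_simps)
  qed
  show thesis
  proof
    fix w
    have "\<zeta> \<bullet> w \<le> p w + e" if "e > 0" for e
    proof -
      (* s *\<^sub>R w is far enough out that the constant \<zeta> \<bullet> v - p v is negligible against s * e. *)
      define s where "s = max 1 ((\<zeta> \<bullet> v - p v) / e)"
      have "s > 0" by (simp add: s_def)
      have "p v + \<zeta> \<bullet> (s *\<^sub>R w - v) \<le> s * p w"
        using sub[of "s *\<^sub>R w"] scale[OF \<open>s > 0\<close>, of w] by linarith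
      moreover have "\<zeta> \<bullet> v - p v \<le> s * e"
        using that by (simp add: s_def pos_divide_le_eq[symmetric])
      ultimately have "s * (\<zeta> \<bullet> w) \<le> s * (p w + e)"
        by (simp add: inner_diff_right algebra_simps)
      then show ?thesis
        using \<open>s > 0\<close> by simp
    qed
    then show "\<zeta> \<bullet> w \<le> p w"
      by (rule field_le_epsilon)
  next
    have "p v + \<zeta> \<bullet> ((1/2) *\<^sub>R v - v) \<le> p ((1/2) *\<^sub>R v)"
      by (rule sub)
    also have "\<dots> \<le> 1/2 * p v"
      by (rule scale) simp
    finally show "p v \<le> \<zeta> \<bullet> v"
      by (simp add: inner_diff_right)
  qed
qed

text \<open>
  This makes the Clarke gradient nonempty and the directional derivative its support function,
  so that bounds on \<open>\<zeta> \<bullet> v\<close> for all gradients \<open>\<zeta>\<close> become bounds on difference quotients.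
\<close>

lemma clarke_derivative_attained:
  fixes f :: "'a::euclidean_space \<Rightarrow> real"
  assumes lip: "L-lipschitz_on N f" and N: "open N" "x \<in> N"
  obtains \<zeta> where "\<zeta> \<in> clarke_gradient f x" "clarke_derivative f x v \<le> ereal (\<zeta> \<bullet> v)"
proof -
  define p where "p v = real_of_ereal (clarke_derivative f x v)" for v
  have p: "clarke_derivative f x v = ereal (p v)" for v
    using clarke_derivative_abs_le[OF lip N, of v] unfolding p_def
    by (cases "clarke_derivative f x v") auto
  have "p (y + z) \<le> p y + p z" for y z
  proof (rule field_le_epsilon)
    fix e :: real assume "e > 0"
    then have "clarke_derivative f x (y + z) \<le> ereal ((p y + e / 2) + (p z + e / 2))"
      by (intro clarke_derivative_add_less) (auto simp: p)
    then show "p (y + z) \<le> p y + p z + e"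
      by (simp add: p)
  qed
  moreover have "p (s *\<^sub>R y) \<le> s * p y" if "s > 0" for s y
    using clarke_derivative_scaleR[OF that, of f x y] by (simp add: p)
  ultimately obtain \<zeta> where "\<And>w. \<zeta> \<bullet> w \<le> p w" "p v \<le> \<zeta> \<bullet> v"
    using sublinear_attained_by_inner[of p v] by blast
  then show thesis
    by (intro that[of \<zeta>]) (auto simp: clarke_gradient_def p)
qed

text \<open>
  Test the defining inequality of the gradient with the direction \<open>\<zeta>\<close> itself.
\<close>

lemma norm_clarke_gradient_le:
  assumes lip: "L-lipschitz_on N f" and N: "open N" "x \<in> N" and \<zeta>: "\<zeta> \<in> clarke_gradient f x"
  shows "norm \<zeta> \<le> L"
proof (cases "\<zeta> = 0")
  case True
  with lip show ?thesis by (simp add: lipschitz_on_def)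
next
  case False
  have "ereal (\<zeta> \<bullet> \<zeta>) \<le> clarke_derivative f x \<zeta>"
    using \<zeta> by (simp add: clarke_gradient_def)
  also have "\<dots> \<le> \<bar>clarke_derivative f x \<zeta>\<bar>"
    by (cases "clarke_derivative f x \<zeta>") auto
  also have "\<dots> \<le> ereal (L * norm \<zeta>)"
    by (rule clarke_derivative_abs_le[OF lip N])
  finally have "norm \<zeta> * norm \<zeta> \<le> L * norm \<zeta>"
    by (simp add: power2_norm_eq_inner[symmetric] power2_eq_square)
  with False show ?thesis by simp
qed

text \<open>
  The gradients near \<open>x\<close> lie in a common ball, and limits of gradients at points tending to
  \<open>x\<close> are gradients at \<open>x\<close> because the directional derivative is upper semicontinuous in the
  base point; by compactness nearby gradients are uniformly close to the one at \<open>x\<close>.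
\<close>

lemma clarke_gradient_usc:
  fixes f :: "'a::euclidean_space \<Rightarrow> real"
  assumes lip: "L-lipschitz_on N f" and N: "open N" "x \<in> N" and "\<epsilon> > 0"
  obtains \<delta> where "\<delta> > 0"
    "\<And>y \<zeta>. dist y x < \<delta> \<Longrightarrow> \<zeta> \<in> clarke_gradient f y \<Longrightarrow> \<exists>\<zeta>0\<in>clarke_gradient f x. dist \<zeta> \<zeta>0 < \<epsilon>"
proof (rule ccontr)
  note obtained = that
  assume "\<not> thesis"
  have bad: "\<exists>y \<zeta>. dist y x < \<delta> \<and> \<zeta> \<in> clarke_gradient f y \<and>
      (\<forall>\<zeta>0\<in>clarke_gradient f x. \<epsilon> \<le> dist \<zeta> \<zeta>0)" if \<delta>: "\<delta> > 0" for \<delta>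
    using \<open>\<not> thesis\<close> obtained[OF \<delta>] by (force simp: not_less)
  obtain e where e: "e > 0" "ball x e \<subseteq> N"
    using N openE by blast
  have "\<forall>n. \<exists>y \<zeta>. dist y x < e / Suc n \<and> \<zeta> \<in> clarke_gradient f y \<and>
      (\<forall>\<zeta>0\<in>clarke_gradient f x. \<epsilon> \<le> dist \<zeta> \<zeta>0)"
    using bad e by auto
  then obtain y \<zeta> where y: "\<And>n. dist (y n) x < e / Suc n"
    and \<zeta>: "\<And>n. \<zeta> n \<in> clarke_gradient f (y n)"
    and far: "\<And>n \<zeta>0. \<zeta>0 \<in> clarke_gradient f x \<Longrightarrow> \<epsilon> \<le> dist (\<zeta> n) \<zeta>0"
    by metis
  have yx: "y \<longlonglongrightarrow> x"
    unfolding tendsto_dist_iff[of y]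
  proof (rule tendsto_sandwich[of "\<lambda>_. 0"])
    show "(\<lambda>n. e / Suc n) \<longlonglongrightarrow> 0"
      using LIMSEQ_Suc[OF lim_const_over_n[of e]] by simp
  qed (use y in \<open>auto intro!: always_eventually less_imp_le\<close>)
  have "norm (\<zeta> n) \<le> L" for n
  proof (rule norm_clarke_gradient_le[OF lip N(1) _ \<zeta>])
    have "e / Suc n \<le> e" using e by (simp add: field_simps)
    with y[of n] e show "y n \<in> N" by (force simp: dist_commute)
  qed
  then have "\<forall>n. \<zeta> n \<in> cball 0 L" by simp
  then obtain l r where r: "strict_mono r" "(\<zeta> \<circ> r) \<longlonglongrightarrow> l"
    by (metis compact_cball compact_imp_seq_compact seq_compactE)
  have "ereal (l \<bullet> v) \<le> clarke_derivative f x v" for v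
  proof (rule dense_ge)
    fix c assume "clarke_derivative f x v < c"
    then have "\<forall>\<^sub>F z in nhds x. clarke_derivative f z v \<le> c"
      by (rule clarke_derivative_usc)
    moreover have "(y \<circ> r) \<longlonglongrightarrow> x"
      using yx r LIMSEQ_subseq_LIMSEQ by blast
    ultimately have "\<forall>\<^sub>F n in sequentially. clarke_derivative f (y (r n)) v \<le> c"
      unfolding filterlim_iff comp_def by blast
    then have "\<forall>\<^sub>F n in sequentially. ereal (\<zeta> (r n) \<bullet> v) \<le> c"
    proof eventually_elim
      case (elim n)
      then show ?case
        using \<zeta>[of "r n"] unfolding clarke_gradient_def by (auto intro: order_trans)
    qed
    moreover have "(\<lambda>n. ereal (\<zeta> (r n) \<bullet> v)) \<longlonglongrightarrow> ereal (l \<bullet> v)"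
      using r(2) unfolding comp_def by (intro tendsto_intros)
    ultimately show "ereal (l \<bullet> v) \<le> c"
      by (intro tendsto_upperbound[OF _ _ sequentially_bot])
  qed
  then have "l \<in> clarke_gradient f x"
    by (simp add: clarke_gradient_def)
  moreover have "\<forall>\<^sub>F n in sequentially. dist (\<zeta> (r n)) l < \<epsilon>"
    using r(2) \<open>\<epsilon> > 0\<close> by (simp add: tendsto_iff)
  then obtain n where "dist (\<zeta> (r n)) l < \<epsilon>"
    using eventually_happens'[OF sequentially_bot] by blast
  ultimately show False
    using far[of l "r n"] by simp
qed

section \<open>The decrease condition\<close>

text \<open>
  Strict negativity of the extended real supremum yields a uniform real margin, also when the
  supremum is \<open>-\<infinity>\<close>.
\<close>

lemma clarke_sup_neg_iff:
  "clarke_sup B F x u < 0 \<longleftrightarrow>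
    (\<exists>c<0. \<forall>\<zeta>\<in>clarke_gradient B x. \<forall>\<eta>\<in>F (x, u). \<zeta> \<bullet> \<eta> \<le> c)"
proof
  assume "clarke_sup B F x u < 0"
  then obtain c where "clarke_sup B F x u < ereal c" "ereal c < 0"
    using ereal_dense2 by blast
  moreover have "ereal (\<zeta> \<bullet> \<eta>) \<le> clarke_sup B F x u"
    if "\<zeta> \<in> clarke_gradient B x" "\<eta> \<in> F (x, u)" for \<zeta> \<eta>
    unfolding clarke_sup_def using that by (intro Sup_upper) blast
  ultimately show "\<exists>c<0. \<forall>\<zeta>\<in>clarke_gradient B x. \<forall>\<eta>\<in>F (x, u). \<zeta> \<bullet> \<eta> \<le> c"
    by (intro exI[of _ c]) (force simp: less_imp_le dest: order_le_less_trans)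
next
  assume "\<exists>c<0. \<forall>\<zeta>\<in>clarke_gradient B x. \<forall>\<eta>\<in>F (x, u). \<zeta> \<bullet> \<eta> \<le> c"
  then obtain c where c: "c < 0" "\<forall>\<zeta>\<in>clarke_gradient B x. \<forall>\<eta>\<in>F (x, u). \<zeta> \<bullet> \<eta> \<le> c"
    by blast
  then have "clarke_sup B F x u \<le> ereal c"
    unfolding clarke_sup_def by (intro Sup_least) auto
  with c show "clarke_sup B F x u < 0"
    by (simp add: order_le_less_trans)
qed

text \<open>
  Convexity of \<open>F\<close> in \<open>u\<close> makes \<open>clarke_sup B F x\<close> a convex function on \<open>Cu\<close>; the set
  below is the part in \<open>U\<close> of a strict sublevel set.
\<close>

lemma convex_decreasing_controls:
  assumes F: "convex_in_control Cx Cu F" and x: "x \<in> Cx" and U: "convex U" "U \<subseteq> Cu"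
  shows "convex {u \<in> U. clarke_sup B F x u < 0}"
  unfolding convex_alt
proof (intro ballI allI impI)
  fix u2 u1 and \<theta> :: real
  assume u: "u2 \<in> {u \<in> U. clarke_sup B F x u < 0}" "u1 \<in> {u \<in> U. clarke_sup B F x u < 0}"
    and \<theta>: "0 \<le> \<theta> \<and> \<theta> \<le> 1"
  then obtain c1 c2 where c: "c1 < 0" "c2 < 0"
    and c1: "\<And>\<zeta> \<eta>. \<zeta> \<in> clarke_gradient B x \<Longrightarrow> \<eta> \<in> F (x, u1) \<Longrightarrow> \<zeta> \<bullet> \<eta> \<le> c1"
    and c2: "\<And>\<zeta> \<eta>. \<zeta> \<in> clarke_gradient B x \<Longrightarrow> \<eta> \<in> F (x, u2) \<Longrightarrow> \<zeta> \<bullet> \<eta> \<le> c2"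
    by (auto simp: clarke_sup_neg_iff)
  let ?u = "(1 - \<theta>) *\<^sub>R u2 + \<theta> *\<^sub>R u1"
  have "?u \<in> U"
    using U(1) u \<theta> by (simp add: convex_alt)
  moreover have "\<zeta> \<bullet> \<eta> \<le> max c1 c2" if \<zeta>: "\<zeta> \<in> clarke_gradient B x" and \<eta>: "\<eta> \<in> F (x, ?u)" for \<zeta> \<eta>
  proof -
    have "u1 \<in> Cu" "u2 \<in> Cu" "\<theta> \<in> {0..1}"
      using u U(2) \<theta> by auto
    then have "F (x, \<theta> *\<^sub>R u1 + (1 - \<theta>) *\<^sub>R u2) \<subseteq> (*\<^sub>R) \<theta> ` F (x, u1) + (*\<^sub>R) (1 - \<theta>) ` F (x, u2)"
      using F x unfolding convex_in_control_def by blast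
    with \<eta> have "\<eta> \<in> (*\<^sub>R) \<theta> ` F (x, u1) + (*\<^sub>R) (1 - \<theta>) ` F (x, u2)"
      by (auto simp: add.commute[of "(1 - \<theta>) *\<^sub>R u2"])
    then obtain \<eta>1 \<eta>2 where \<eta>12: "\<eta>1 \<in> F (x, u1)" "\<eta>2 \<in> F (x, u2)"
      "\<eta> = \<theta> *\<^sub>R \<eta>1 + (1 - \<theta>) *\<^sub>R \<eta>2"
      by (auto elim!: set_plus_elim)
    have "\<zeta> \<bullet> \<eta> = \<theta> * (\<zeta> \<bullet> \<eta>1) + (1 - \<theta>) * (\<zeta> \<bullet> \<eta>2)"
      by (simp add: \<eta>12 inner_add_right)
    also have "\<dots> \<le> max c1 c2"
      using \<theta> c1[OF \<zeta> \<eta>12(1)] c2[OF \<zeta> \<eta>12(2)] by (intro convex_bound_le) auto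
    finally show ?thesis .
  qed
  then have "clarke_sup B F x ?u < 0"
    unfolding clarke_sup_neg_iff using c by (intro exI[of _ "max c1 c2"]) auto
  ultimately show "?u \<in> {u \<in> U. clarke_sup B F x u < 0}" by simp
qed

text \<open>
  Both factors of \<open>\<zeta> \<bullet> \<eta>\<close> range over bounded, upper semicontinuous sets, so the slack in the
  strict inequality absorbs their perturbation.
\<close>

lemma open_decreasing_controls:
  fixes B :: "'a::euclidean_space \<Rightarrow> real" and F :: "'a \<times> 'b::topological_space \<Rightarrow> 'a set"
  assumes B: "locally_lipschitz B" and F: "set_usc_on C F" and z: "(x, u) \<in> C"
    and bounded: "bounded (F (x, u))" and neg: "clarke_sup B F x u < 0"
  obtains M where "open M" "(x, u) \<in> M" "\<And>y w. (y, w) \<in> M \<inter> C \<Longrightarrow> clarke_sup B F y w < 0"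
proof -
  obtain N L where lip: "L-lipschitz_on N B" and N: "open N" "x \<in> N"
    using B unfolding locally_lipschitz_def by blast
  have "L \<ge> 0"
    using lip by (simp add: lipschitz_on_def)
  obtain R where R: "R > 0" "\<And>\<eta>. \<eta> \<in> F (x, u) \<Longrightarrow> norm \<eta> \<le> R"
    using bounded unfolding bounded_pos by blast
  obtain c where c: "c < 0" "\<And>\<zeta> \<eta>. \<zeta> \<in> clarke_gradient B x \<Longrightarrow> \<eta> \<in> F (x, u) \<Longrightarrow> \<zeta> \<bullet> \<eta> \<le> c"
    using neg unfolding clarke_sup_neg_iff by blast
  (* Moving each factor by \<epsilon> changes the inner product by at most \<epsilon> * (L + R), hence by at
     most half of the slack - c. *)
  define \<epsilon> where "\<epsilon> = - c / (2 * (L + R + 1))"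
  have "\<epsilon> > 0"
    using c \<open>L \<ge> 0\<close> R by (simp add: \<epsilon>_def divide_neg_pos)
  obtain \<delta> where \<delta>: "\<delta> > 0" "\<And>y \<zeta>. dist y x < \<delta> \<Longrightarrow> \<zeta> \<in> clarke_gradient B y \<Longrightarrow>
      \<exists>\<zeta>0\<in>clarke_gradient B x. dist \<zeta> \<zeta>0 < \<epsilon>"
    using clarke_gradient_usc[OF lip N \<open>\<epsilon> > 0\<close>] by blast
  obtain M where M: "open M" "(x, u) \<in> M"
    "\<And>z. z \<in> M \<inter> C \<Longrightarrow> F z \<subseteq> F (x, u) + (*\<^sub>R) \<epsilon> ` cball 0 1"
    using F z \<open>\<epsilon> > 0\<close> unfolding set_usc_on_def by meson
  show thesis
  proof
    show "open (M \<inter> (ball x \<delta> \<inter> N) \<times> UNIV)"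
      using M N by (intro open_Int open_Times) auto
    show "(x, u) \<in> M \<inter> (ball x \<delta> \<inter> N) \<times> UNIV"
      using M N \<delta> by auto
    fix y w assume yw: "(y, w) \<in> (M \<inter> (ball x \<delta> \<inter> N) \<times> UNIV) \<inter> C"
    have "\<zeta> \<bullet> \<eta> \<le> c / 2" if \<zeta>: "\<zeta> \<in> clarke_gradient B y" and \<eta>: "\<eta> \<in> F (y, w)" for \<zeta> \<eta>
    proof -
      obtain \<zeta>0 where \<zeta>0: "\<zeta>0 \<in> clarke_gradient B x" "dist \<zeta> \<zeta>0 < \<epsilon>"
        using \<delta>(2)[OF _ \<zeta>] yw by (auto simp: dist_commute)
      obtain \<eta>0 where \<eta>0: "\<eta>0 \<in> F (x, u)" "norm (\<eta> - \<eta>0) \<le> \<epsilon>"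
        using M(3)[of "(y, w)"] yw \<eta> \<open>\<epsilon> > 0\<close> by (fastforce elim!: set_plus_elim)
      have "norm \<zeta> \<le> L"
        using norm_clarke_gradient_le[OF lip N(1) _ \<zeta>] yw by auto
      have "\<zeta> \<bullet> \<eta> = \<zeta>0 \<bullet> \<eta>0 + (\<zeta> - \<zeta>0) \<bullet> \<eta>0 + \<zeta> \<bullet> (\<eta> - \<eta>0)"
        by (simp add: inner_diff_left inner_diff_right)
      also have "\<dots> \<le> c + norm (\<zeta> - \<zeta>0) * norm \<eta>0 + norm \<zeta> * norm (\<eta> - \<eta>0)"
        using c(2)[OF \<zeta>0(1) \<eta>0(1)] by (intro add_mono norm_cauchy_schwarz)
      also have "\<dots> \<le> c + \<epsilon> * R + L * \<epsilon>"
        using \<zeta>0 \<eta>0 R \<open>norm \<zeta> \<le> L\<close> \<open>\<epsilon> > 0\<close> \<open>L \<ge> 0\<close>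
        by (intro add_mono mult_mono order_refl) (auto simp: dist_norm)
      also have "\<dots> \<le> c + \<epsilon> * (L + R + 1)"
        using \<open>\<epsilon> > 0\<close> by (simp add: algebra_simps)
      also have "\<dots> = c / 2"
        using \<open>L \<ge> 0\<close> R by (simp add: \<epsilon>_def field_simps)
      finally show ?thesis .
    qed
    then show "clarke_sup B F y w < 0"
      unfolding clarke_sup_neg_iff using c by (intro exI[of _ "c / 2"]) auto
  qed
qed

section \<open>Monotonicity along absolutely continuous curves\<close>

text \<open>
  A division of \<open>{a..b}\<close> that is fine for a suitable gauge has two kinds of pieces. Those
  tagged where \<open>f\<close> locally decreases contribute nothing positive to \<open>f b - f a\<close>; the others
  lie in an open set of small measure covering the exceptional null set, so absolute continuity
  makes their contribution small.
\<close>

lemma absolutely_continuous_nonincreasing: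
  fixes f :: "real \<Rightarrow> real"
  assumes "a \<le> b" and ac: "absolutely_continuous_on_interval a b f"
    and ae: "AE t in lebesgue. t \<in> {a..b} \<longrightarrow>
      (\<exists>d>0. \<forall>l\<in>{a..t}. \<forall>r\<in>{t..b}. r - l < d \<longrightarrow> f r \<le> f l)"
  shows "f b \<le> f a"
proof (rule field_le_epsilon)
  fix \<epsilon> :: real assume "\<epsilon> > 0"
  then obtain \<delta> where "\<delta> > 0" and \<delta>: "\<And>(n::nat) l r.
      (\<forall>k<n. a \<le> l k \<and> l k \<le> r k \<and> r k \<le> b) \<and>
      disjoint_family_on (\<lambda>k. {l k<..<r k}) {..<n} \<and> (\<Sum>k<n. r k - l k) < \<delta>
      \<Longrightarrow> (\<Sum>k<n. dist (f (l k)) (f (r k))) < \<epsilon>"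
    using ac unfolding absolutely_continuous_on_interval_def by meson
  define decr where "decr t d \<longleftrightarrow> (\<forall>l\<in>{a..t}. \<forall>r\<in>{t..b}. r - l < d \<longrightarrow> f r \<le> f l)" for t d
  have "AE t in lebesgue. t \<in> {a..b} \<longrightarrow> (\<exists>d>0. decr t d)"
    using ae by (simp only: decr_def)
  then obtain N where N: "N \<in> null_sets lebesgue"
    and sub: "{t \<in> space lebesgue. \<not> (t \<in> {a..b} \<longrightarrow> (\<exists>d>0. decr t d))} \<subseteq> N"
    unfolding eventually_ae_filter by (elim bexE)
  have good: "\<exists>d>0. decr t d" if "t \<notin> N" "t \<in> {a..b}" for t
  proof (rule ccontr)
    assume "\<not> ?thesis"
    then have "t \<in> {t \<in> space lebesgue. \<not> (t \<in> {a..b} \<longrightarrow> (\<exists>d>0. decr t d))}"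
      using \<open>t \<in> {a..b}\<close> by simp
    with sub \<open>t \<notin> N\<close> show False by blast
  qed
  obtain G where G: "open G" "N \<subseteq> G" "G - N \<in> lmeasurable" "emeasure lebesgue (G - N) < ennreal \<delta>"
    using sets_lebesgue_outer_open[OF null_setsD2[OF N] \<open>\<delta> > 0\<close>] by blast
  have "G \<in> sets lebesgue"
    using G(1) by (simp add: borel_open)
  then have emG: "emeasure lebesgue G < ennreal \<delta>"
    using G(4) emeasure_Diff_null_set[OF N] by simp
  have Gm: "G \<in> lmeasurable"
    using \<open>G \<in> sets lebesgue\<close> emG by (intro fmeasurableI) (auto intro: order.strict_trans)
  then have mG: "measure lebesgue G < \<delta>"
    using emG \<open>\<delta> > 0\<close> by (simp add: emeasure_eq_measure2 ennreal_less_iff)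
  obtain d where d: "\<And>t. t \<notin> N \<Longrightarrow> t \<in> {a..b} \<Longrightarrow> d t > 0 \<and> decr t (d t)"
    using good by metis
  define \<gamma> where "\<gamma> t = (if t \<in> N then G else if t \<in> {a..b} then ball t (d t / 2) else UNIV)" for t
  have "gauge \<gamma>"
    unfolding gauge_def \<gamma>_def using G d by auto
  then obtain p where p: "p tagged_division_of {a..b}" "\<gamma> fine p"
    by (rule fine_division_exists_real)
  have piece: "\<exists>u v. K = {u..v} \<and> a \<le> u \<and> u \<le> x \<and> x \<le> v \<and> v \<le> b \<and> Inf K = u \<and> Sup K = v \<and> K \<subseteq> \<gamma> x"
    if xK: "(x, K) \<in> p" for x K
  proof -
    obtain u v where K: "K = cbox u v"
      using tagged_division_ofD(4)[OF p(1) xK] by blast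
    have "x \<in> K" "K \<subseteq> {a..b}"
      using tagged_division_ofD(2,3)[OF p(1) xK] .
    moreover have "K \<subseteq> \<gamma> x"
      using p(2) xK unfolding fine_def by blast
    ultimately show ?thesis
      using K by (intro exI[of _ u] exI[of _ v]) auto
  qed
  have finp: "finite p"
    using p(1) by blast
  (* The absolute continuity condition is stated for intervals indexed by an initial segment
     of nat, hence the enumeration h of the pieces tagged in N. *)
  define Bad where "Bad = {z \<in> p. fst z \<in> N}"
  have finB: "finite Bad"
    using finp by (simp add: Bad_def)
  define n where "n = card Bad"
  obtain h where h: "bij_betw h {0..<n} Bad"
    using ex_bij_betw_nat_finite[OF finB] unfolding n_def by blast
  then have h': "bij_betw h {..<n} Bad"
    by (simp add: atLeast0LessThan)
  define l r where "l k = Inf (snd (h k))" and "r k = Sup (snd (h k))" for k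
  have hk: "h k \<in> p \<and> fst (h k) \<in> N" if "k < n" for k
    using bij_betwE[OF h'] that by (auto simp: Bad_def)
  have lr: "a \<le> l k \<and> l k \<le> r k \<and> r k \<le> b \<and> snd (h k) = {l k..r k} \<and> {l k..r k} \<subseteq> G" if "k < n" for k
    using piece[of "fst (h k)" "snd (h k)"] hk[OF that] unfolding l_def r_def
    by (auto simp: \<gamma>_def)
  have disj: "disjoint_family_on (\<lambda>k. {l k<..<r k}) {..<n}"
    unfolding disjoint_family_on_def
  proof (intro ballI impI)
    fix i j assume ij: "i \<in> {..<n}" "j \<in> {..<n}" "i \<noteq> j"
    then have "h i \<noteq> h j"
      using h' by (auto simp: bij_betw_def inj_on_def)
    then have "interior (snd (h i)) \<inter> interior (snd (h j)) = {}"
      using tagged_division_ofD(5)[OF p(1), of "fst (h i)" "snd (h i)" "fst (h j)" "snd (h j)"]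
        hk ij by (auto simp: prod_eq_iff)
    then show "{l i<..<r i} \<inter> {l j<..<r j} = {}"
      using lr ij by simp
  qed
  have "(\<Sum>k<n. r k - l k) = (\<Sum>k<n. measure lebesgue {l k<..<r k})"
    using lr by (intro sum.cong) auto
  also have "\<dots> = measure lebesgue (\<Union>k<n. {l k<..<r k})"
    by (rule measure_finite_Union[symmetric]) (use disj lr in auto)
  also have "\<dots> \<le> measure lebesgue G"
    using lr Gm by (intro measure_mono_fmeasurable) (fastforce simp: less_imp_le)+
  finally have "(\<Sum>k<n. dist (f (l k)) (f (r k))) < \<epsilon>"
    using mG disj lr by (intro \<delta>) auto
  moreover have "(\<Sum>(x, K)\<in>Bad. f (Sup K) - f (Inf K)) \<le> (\<Sum>k<n. dist (f (l k)) (f (r k)))"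
  proof -
    have "(\<Sum>(x, K)\<in>Bad. f (Sup K) - f (Inf K)) = (\<Sum>k<n. f (r k) - f (l k))"
      using sum.reindex_bij_betw[OF h', of "\<lambda>z. f (Sup (snd z)) - f (Inf (snd z))"]
      by (simp add: case_prod_unfold l_def r_def)
    also have "\<dots> \<le> (\<Sum>k<n. dist (f (l k)) (f (r k)))"
      by (intro sum_mono) (simp add: dist_real_def)
    finally show ?thesis .
  qed
  moreover have "(\<Sum>(x, K)\<in>p - Bad. f (Sup K) - f (Inf K)) \<le> 0"
  proof (rule sum_nonpos, clarify)
    fix x K assume xK: "(x, K) \<in> p" "(x, K) \<notin> Bad"
    then obtain u v where uv: "K = {u..v}" "a \<le> u" "u \<le> x" "x \<le> v" "v \<le> b" "Inf K = u" "Sup K = v"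
      "K \<subseteq> \<gamma> x"
      using piece by blast
    have x: "x \<notin> N" "x \<in> {a..b}"
      using xK uv by (auto simp: Bad_def)
    then have "{u..v} \<subseteq> ball x (d x / 2)"
      using uv by (simp add: \<gamma>_def)
    moreover have "u \<in> {u..v}" "v \<in> {u..v}"
      using uv by auto
    ultimately have "u \<in> ball x (d x / 2)" "v \<in> ball x (d x / 2)"
      by blast+
    then have "v - u < d x"
      using uv by (simp add: dist_real_def)
    then have "f v \<le> f u"
      using d[OF x] uv by (auto simp: decr_def)
    then show "f (Sup K) - f (Inf K) \<le> 0"
      using uv by simp
  qed
  moreover have "(\<Sum>(x, K)\<in>p. f (Sup K) - f (Inf K)) =
      (\<Sum>(x, K)\<in>p - Bad. f (Sup K) - f (Inf K)) + (\<Sum>(x, K)\<in>Bad. f (Sup K) - f (Inf K))"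
    by (rule sum.subset_diff[OF _ finp]) (auto simp: Bad_def)
  ultimately show "f b \<le> f a + \<epsilon>"
    using additive_tagged_division_1[OF \<open>a \<le> b\<close> p(1), of f] by linarith
qed

lemma absolutely_continuous_lipschitz_compose:
  assumes ac: "absolutely_continuous_on_interval a b x"
    and lip: "L-lipschitz_on N f" and N: "x ` {a..b} \<subseteq> N"
  shows "absolutely_continuous_on_interval a b (\<lambda>t. f (x t))"
  unfolding absolutely_continuous_on_interval_def
proof (intro allI impI)
  fix \<epsilon> :: real assume "\<epsilon> > 0"
  have "L \<ge> 0"
    using lip by (simp add: lipschitz_on_def)
  then have "\<epsilon> / (L + 1) > 0"
    using \<open>\<epsilon> > 0\<close> by simp
  then obtain \<delta> where "\<delta> > 0" and \<delta>: "\<And>(n::nat) l r.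
      (\<forall>k<n. a \<le> l k \<and> l k \<le> r k \<and> r k \<le> b) \<and>
      disjoint_family_on (\<lambda>k. {l k<..<r k}) {..<n} \<and> (\<Sum>k<n. r k - l k) < \<delta>
      \<Longrightarrow> (\<Sum>k<n. dist (x (l k)) (x (r k))) < \<epsilon> / (L + 1)"
    using ac unfolding absolutely_continuous_on_interval_def by meson
  show "\<exists>\<delta>>0. \<forall>(n::nat) l r.
      (\<forall>k<n. a \<le> l k \<and> l k \<le> r k \<and> r k \<le> b) \<and>
      disjoint_family_on (\<lambda>k. {l k<..<r k}) {..<n} \<and> (\<Sum>k<n. r k - l k) < \<delta>
      \<longrightarrow> (\<Sum>k<n. dist (f (x (l k))) (f (x (r k)))) < \<epsilon>"
  proof (intro exI[of _ \<delta>] conjI allI impI \<open>\<delta> > 0\<close>)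
    fix n :: nat and l r
    assume asm: "(\<forall>k<n. a \<le> l k \<and> l k \<le> r k \<and> r k \<le> b) \<and>
      disjoint_family_on (\<lambda>k. {l k<..<r k}) {..<n} \<and> (\<Sum>k<n. r k - l k) < \<delta>"
    let ?s = "\<Sum>k<n. dist (x (l k)) (x (r k))"
    have "(\<Sum>k<n. dist (f (x (l k))) (f (x (r k)))) \<le> (\<Sum>k<n. L * dist (x (l k)) (x (r k)))"
    proof (rule sum_mono)
      fix k assume "k \<in> {..<n}"
      then have "l k \<in> {a..b}" "r k \<in> {a..b}"
        using asm by (auto intro: order_trans)
      then show "dist (f (x (l k))) (f (x (r k))) \<le> L * dist (x (l k)) (x (r k))"
        using N by (intro lipschitz_onD[OF lip]) auto
    qed
    also have "\<dots> = L * ?s"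
      by (simp add: sum_distrib_left)
    also have "\<dots> \<le> (L + 1) * ?s"
      by (intro mult_right_mono sum_nonneg) auto
    also have "\<dots> < \<epsilon>"
      using \<delta>[OF asm] \<open>L \<ge> 0\<close> by (simp add: field_simps)
    finally show "(\<Sum>k<n. dist (f (x (l k))) (f (x (r k)))) < \<epsilon>" .
  qed
qed

lemma absolutely_continuous_imp_continuous_on:
  assumes ac: "absolutely_continuous_on_interval a b x"
  shows "continuous_on {a..b} x"
  unfolding continuous_on_iff
proof (intro ballI allI impI)
  fix t \<epsilon> :: real assume t: "t \<in> {a..b}" and "\<epsilon> > 0"
  then obtain \<delta> where "\<delta> > 0" and \<delta>: "\<And>(n::nat) l r.
      (\<forall>k<n. a \<le> l k \<and> l k \<le> r k \<and> r k \<le> b) \<and>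
      disjoint_family_on (\<lambda>k. {l k<..<r k}) {..<n} \<and> (\<Sum>k<n. r k - l k) < \<delta>
      \<Longrightarrow> (\<Sum>k<n. dist (x (l k)) (x (r k))) < \<epsilon>"
    using ac unfolding absolutely_continuous_on_interval_def by meson
  have "dist (x s) (x t) < \<epsilon>" if "s \<in> {a..b}" "dist s t < \<delta>" for s
    using \<delta>[of 1 "\<lambda>_. min s t" "\<lambda>_. max s t"] that t
    by (cases "s \<le> t") (auto simp: dist_real_def disjoint_family_on_def dist_commute)
  with \<open>\<delta> > 0\<close> show "\<exists>d>0. \<forall>s\<in>{a..b}. dist s t < d \<longrightarrow> dist (x s) (x t) < \<epsilon>"
    by blast
qed

section \<open>Safety\<close>

lemma locally_lipschitz_imp_continuous_on:
  assumes "locally_lipschitz f"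
  shows "continuous_on S f"
proof (rule continuous_on_subset[of UNIV])
  show "continuous_on UNIV f"
    unfolding continuous_on_eq_continuous_within
  proof
    fix x
    obtain N L where N: "open N" "x \<in> N" "L-lipschitz_on N f"
      using assms unfolding locally_lipschitz_def by blast
    then have "continuous_on N f"
      by (rule_tac lipschitz_on_continuous_on)
    then show "continuous (at x) f"
      using N continuous_on_eq_continuous_at by blast
  qed
qed simp

text \<open>
  Both endpoints are allowed to differ from \<open>t\<close>: the increment of the curve over \<open>{l..r}\<close> is
  \<open>(r - l) *\<^sub>R v\<close> up to \<open>o(r - l)\<close>, and the Clarke derivative controls difference quotients
  of \<open>B\<close> based at the nearby point \<open>x l\<close> rather than at \<open>x t\<close>.
\<close>

lemma decreasing_along_curve:
  fixes B :: "'a::euclidean_space \<Rightarrow> real"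
  assumes B: "locally_lipschitz B" and t: "t \<in> T"
    and der: "(x has_vector_derivative v) (at t within T)"
    and v: "v \<in> F (x t, u)" and neg: "clarke_sup B F (x t) u < 0"
  obtains d where "d > 0"
    "\<And>l r. l \<in> T \<Longrightarrow> r \<in> T \<Longrightarrow> l \<le> t \<Longrightarrow> t \<le> r \<Longrightarrow> r - l < d \<Longrightarrow> B (x r) \<le> B (x l)"
proof -
  obtain N L where lip: "L-lipschitz_on N B" and N: "open N" "x t \<in> N"
    using B unfolding locally_lipschitz_def by blast
  have "L \<ge> 0"
    using lip by (simp add: lipschitz_on_def)
  obtain e where e: "e > 0" "ball (x t) e \<subseteq> N"
    using N openE by blast
  obtain c where c: "c < 0" "\<And>\<zeta>. \<zeta> \<in> clarke_gradient B (x t) \<Longrightarrow> \<zeta> \<bullet> v \<le> c"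
    using neg v unfolding clarke_sup_neg_iff by blast
  obtain \<zeta> where "\<zeta> \<in> clarke_gradient B (x t)" "clarke_derivative B (x t) v \<le> ereal (\<zeta> \<bullet> v)"
    using clarke_derivative_attained[OF lip N] by blast
  then have "clarke_derivative B (x t) v \<le> ereal c"
    using c(2) by (meson ereal_less_eq(3) order_trans)
  then have "clarke_derivative B (x t) v < ereal (c / 2)"
    using c(1) by (auto intro: le_less_trans)
  then obtain \<delta> where "\<delta> > 0" and \<delta>: "\<And>y h. dist y (x t) < \<delta> \<Longrightarrow> 0 < h \<Longrightarrow> h < \<delta> \<Longrightarrow>
      ereal ((B (y + h *\<^sub>R v) - B y) / h) < ereal (c / 2)"
    using clarke_derivative_lessD by blast
  define \<epsilon> where "\<epsilon> = - c / (2 * (L + 1))"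
  have "\<epsilon> > 0"
    using c \<open>L \<ge> 0\<close> by (simp add: \<epsilon>_def divide_neg_pos)
  have "L * \<epsilon> \<le> - c / 2"
    using c \<open>L \<ge> 0\<close> by (simp add: \<epsilon>_def field_simps)
  obtain d1 where "d1 > 0" and d1: "\<And>s. s \<in> T \<Longrightarrow> \<bar>s - t\<bar> < d1 \<Longrightarrow>
      norm (x s - x t - (s - t) *\<^sub>R v) \<le> \<epsilon> * \<bar>s - t\<bar>"
    using der \<open>\<epsilon> > 0\<close> unfolding has_vector_derivative_def has_derivative_within_alt
    by (metis real_norm_def)
  (* M * (r - l) bounds the distance from x t to x l, to x r, and to the Euler step
     x l + (r - l) *\<^sub>R v, so that all three stay where the estimates for B hold. *)
  define M where "M = 2 * norm v + \<epsilon> + 1"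
  have "M > 0"
    using \<open>\<epsilon> > 0\<close> norm_ge_zero[of v] by (simp add: M_def add_nonneg_pos)
  define d where "d = min (min d1 \<delta>) (min \<delta> e / M)"
  show thesis
  proof
    show "d > 0"
      using \<open>d1 > 0\<close> \<open>\<delta> > 0\<close> \<open>e > 0\<close> \<open>M > 0\<close> by (simp add: d_def)
    fix l r assume lr: "l \<in> T" "r \<in> T" "l \<le> t" "t \<le> r" "r - l < d"
    show "B (x r) \<le> B (x l)"
    proof (cases "l = r")
      case False
      define h where "h = r - l"
      have h: "0 < h" "h < d1" "h < \<delta>" "h * M < \<delta>" "h * M < e"
        using lr False \<open>M > 0\<close> by (auto simp: h_def d_def pos_less_divide_eq)
      have xl: "norm (x l - x t - (l - t) *\<^sub>R v) \<le> \<epsilon> * (t - l)"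
        and xr: "norm (x r - x t - (r - t) *\<^sub>R v) \<le> \<epsilon> * (r - t)"
        using d1[of l] d1[of r] lr h by (auto simp: h_def)
      have small: "norm w \<le> h * norm v + \<epsilon> * h"
        if "norm (w - s *\<^sub>R v) \<le> \<epsilon> * k" "\<bar>s\<bar> \<le> h" "k \<le> h" for w s k
      proof -
        have "norm w \<le> norm (w - s *\<^sub>R v) + norm (s *\<^sub>R v)"
          using norm_triangle_ineq[of "w - s *\<^sub>R v" "s *\<^sub>R v"] by simp
        also have "\<dots> \<le> \<epsilon> * h + h * norm v"
        proof (rule add_mono)
          show "norm (w - s *\<^sub>R v) \<le> \<epsilon> * h"
            using that mult_left_mono[of k h \<epsilon>] \<open>\<epsilon> > 0\<close> by linarith
          show "norm (s *\<^sub>R v) \<le> h * norm v"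
            using that by (simp add: mult_right_mono)
        qed
        finally show ?thesis by simp
      qed
      have hM: "h * norm v + \<epsilon> * h + h * norm v < h * M"
        using h(1) by (simp add: M_def algebra_simps)
      have nv: "0 \<le> h * norm v"
        using h(1) by simp
      have "norm (x l - x t) \<le> h * norm v + \<epsilon> * h"
        by (rule small[OF xl]) (use lr in \<open>auto simp: h_def\<close>)
      moreover have "norm (x r - x t) \<le> h * norm v + \<epsilon> * h"
        by (rule small[OF xr]) (use lr in \<open>auto simp: h_def\<close>)
      moreover have "norm (x l + h *\<^sub>R v - x t) \<le> norm (x l - x t) + h * norm v"
        using norm_triangle_ineq[of "x l - x t" "h *\<^sub>R v"] h(1) by (simp add: algebra_simps)
      ultimately have "norm (x l - x t) < \<delta>" "norm (x r - x t) < e" "norm (x l + h *\<^sub>R v - x t) < e"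
        using hM nv h by linarith+
      then have near: "dist (x l) (x t) < \<delta>" "x r \<in> N" "x l + h *\<^sub>R v \<in> N"
        using e(2) by (auto simp: dist_norm norm_minus_commute)
      have "dist (B (x r)) (B (x l + h *\<^sub>R v)) \<le> L * dist (x r) (x l + h *\<^sub>R v)"
        by (rule lipschitz_onD[OF lip near(2,3)])
      also have "dist (x r) (x l + h *\<^sub>R v) \<le> \<epsilon> * h"
      proof -
        have eq: "x r - (x l + h *\<^sub>R v) = (x r - x t - (r - t) *\<^sub>R v) - (x l - x t - (l - t) *\<^sub>R v)"
          by (simp add: h_def algebra_simps)
        have "dist (x r) (x l + h *\<^sub>R v) \<le> \<epsilon> * (r - t) + \<epsilon> * (t - l)"
          unfolding dist_norm eq by (rule order_trans[OF norm_triangle_ineq4 add_mono[OF xr xl]])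
        then show ?thesis
          by (simp add: h_def algebra_simps)
      qed
      finally have "B (x r) - B (x l + h *\<^sub>R v) \<le> L * (\<epsilon> * h)"
        using \<open>L \<ge> 0\<close> by (simp add: dist_real_def mult_left_mono)
      also have "\<dots> \<le> - c / 2 * h"
        using mult_right_mono[OF \<open>L * \<epsilon> \<le> - c / 2\<close>, of h] h(1) by (simp add: mult.assoc)
      finally have "B (x r) - B (x l + h *\<^sub>R v) \<le> - c / 2 * h" .
      moreover have "B (x l + h *\<^sub>R v) - B (x l) < c / 2 * h"
        using \<delta>[OF near(1) h(1,3)] h(1) by (simp add: pos_divide_less_eq)
      ultimately show ?thesis by simp
    qed simp
  qed
qed

text \<open>
  The sets of decreasing controls are convex but need not be closed, so Michael's theorem does
  not apply to them. Instead, a selection of \<open>\<U>\<close> through a decreasing control at one point is decreasing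
  on a neighbourhood, by openness, and such selections are glued together.
\<close>

lemma decreasing_continuous_control:
  fixes F :: "'a::euclidean_space \<times> 'b::euclidean_space \<Rightarrow> 'a set"
  assumes lsc: "set_lsc_on Cx \<U>"
    and U: "\<And>x. x \<in> Cx \<Longrightarrow> \<U> x \<noteq> {} \<and> closed (\<U> x) \<and> convex (\<U> x) \<and> \<U> x \<subseteq> Cu"
    and F: "set_usc_on (Cx \<times> Cu) F" "\<And>z. z \<in> Cx \<times> Cu \<Longrightarrow> bounded (F z)"
      "convex_in_control Cx Cu F"
    and B: "locally_lipschitz B" and "closed T"
    and D: "\<And>x. x \<in> T \<inter> Cx \<Longrightarrow> {u \<in> \<U> x. clarke_sup B F x u < 0} \<noteq> {}"
  obtains \<kappa> where "continuous_on Cx \<kappa>" "\<And>x. x \<in> Cx \<Longrightarrow> \<kappa> x \<in> \<U> x"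
    "\<And>x. x \<in> T \<inter> Cx \<Longrightarrow> clarke_sup B F x (\<kappa> x) < 0"
proof -
  define \<Phi> where "\<Phi> x = (if x \<in> T then {u \<in> \<U> x. clarke_sup B F x u < 0} else \<U> x)" for x
  have U': "\<And>x. x \<in> Cx \<Longrightarrow> \<U> x \<noteq> {} \<and> closed (\<U> x) \<and> convex (\<U> x)"
    using U by blast
  obtain \<kappa> where \<kappa>: "continuous_on Cx \<kappa>" "\<And>x. x \<in> Cx \<Longrightarrow> \<kappa> x \<in> \<Phi> x"
  proof (rule glue_local_selections[where S = Cx and \<Phi> = \<Phi>])
    show "convex (\<Phi> x)" if "x \<in> Cx" for x
      using U[OF that] convex_decreasing_controls[OF F(3) that] by (simp add: \<Phi>_def)
  next
    fix x assume x: "x \<in> Cx"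
    show "\<exists>N f. open N \<and> x \<in> N \<and> continuous_on Cx f \<and> (\<forall>y\<in>Cx \<inter> N. f y \<in> \<Phi> y)"
    proof (cases "x \<in> T")
      case False
      obtain f where "continuous_on Cx f" "\<And>y. y \<in> Cx \<Longrightarrow> f y \<in> \<U> y"
        using michael_selection[OF lsc U'] by blast
      then show ?thesis
        using False \<open>closed T\<close> by (intro exI[of _ "- T"] exI[of _ f]) (auto simp: \<Phi>_def)
    next
      case True
      then obtain u where u: "u \<in> \<U> x" "clarke_sup B F x u < 0"
        using D[of x] x by blast
      obtain f where f: "continuous_on Cx f" "\<And>y. y \<in> Cx \<Longrightarrow> f y \<in> \<U> y" "f x = u"
        using michael_selection_through_point[OF lsc U' x u(1)] by blast
      have xu: "(x, u) \<in> Cx \<times> Cu"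
        using x u U by blast
      obtain M where M: "open M" "(x, u) \<in> M"
        "\<And>y w. (y, w) \<in> M \<inter> Cx \<times> Cu \<Longrightarrow> clarke_sup B F y w < 0"
        using open_decreasing_controls[OF B F(1) xu F(2)[OF xu] u(2)] by blast
      have "continuous_on Cx (\<lambda>y. (y, f y))"
        by (intro continuous_intros f)
      then obtain N where N: "open N" "N \<inter> Cx = (\<lambda>y. (y, f y)) -` M \<inter> Cx"
        using M(1) unfolding continuous_on_open_invariant by blast
      have "f y \<in> \<Phi> y" if y: "y \<in> Cx \<inter> N" for y
      proof -
        have "(y, f y) \<in> M \<inter> Cx \<times> Cu"
          using y N(2) f(2)[of y] U[of y] by blast
        then show ?thesis
          using M(3) f(2) y by (auto simp: \<Phi>_def)
      qed
      moreover have "x \<in> N"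
        using N(2) M(2) f(3) x by blast
      ultimately show ?thesis
        using N f by blast
    qed
  qed blast
  show thesis
  proof
    show "continuous_on Cx \<kappa>"
      by (rule \<kappa>)
    show "\<kappa> x \<in> \<U> x" if "x \<in> Cx" for x
      using \<kappa>(2)[OF that] by (auto simp: \<Phi>_def split: if_splits)
    show "clarke_sup B F x (\<kappa> x) < 0" if "x \<in> T \<inter> Cx" for x
      using \<kappa>(2)[of x] that by (auto simp: \<Phi>_def)
  qed
qed

text \<open>
  A trajectory reaching \<open>Xu\<close> has a last time \<open>t0\<close> in \<open>K = barrier_set Cx B\<close>. Just after \<open>t0\<close> it runs outside \<open>K\<close>
  but close to \<open>frontier K\<close>, where \<open>B\<close> decreases; so \<open>B\<close> cannot become positive.
\<close>

lemma safe_if_decreasing_near_frontier: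
  fixes B :: "'a::euclidean_space \<Rightarrow> real" and F :: "'a \<times> 'b \<Rightarrow> 'a set"
  assumes B: "locally_lipschitz B" "barrier_candidate Xo Xu B" and "Xo \<subseteq> Cx"
    and A: "open A" "frontier (barrier_set Cx B) \<subseteq> A"
    and neg: "\<And>x. x \<in> A \<inter> Cx - interior (barrier_set Cx B) \<Longrightarrow> clarke_sup B F x (\<kappa> x) < 0"
  shows "safe_inclusion (\<lambda>x. F (x, \<kappa> x)) Cx Xo Xu"
  unfolding safe_inclusion_def
proof (intro allI impI ballI, rule ComplI)
  let ?K = "barrier_set Cx B"
  fix I x t1
  assume sol: "inclusion_solution (\<lambda>x. F (x, \<kappa> x)) Cx I x \<and> x 0 \<in> Xo"
    and t1: "t1 \<in> I" and "x t1 \<in> Xu"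
  then have Bt1: "B (x t1) > 0" and B0: "B (x 0) \<le> 0" and "x 0 \<in> Cx"
    using B(2) \<open>Xo \<subseteq> Cx\<close> by (auto simp: barrier_candidate_def)
  have I: "is_interval I" "0 \<in> I" "I \<subseteq> {0..}"
    and ac: "locally_absolutely_continuous_on I x"
    and inC: "\<And>t. t \<in> interior I \<Longrightarrow> x t \<in> Cx"
    and ae: "AE t in lebesgue. t \<in> I \<longrightarrow>
      (\<exists>v\<in>F (x t, \<kappa> (x t)). (x has_vector_derivative v) (at t within I))"
    using sol by (auto simp: inclusion_solution_def)
  have "t1 \<ge> 0"
    using I t1 by auto
  have sub: "{0..t1} \<subseteq> I"
    by (meson I(1,2) atLeastAtMost_iff mem_is_interval_1_I subsetI t1)
  have ac_on: "absolutely_continuous_on_interval a b x" if "0 \<le> a" "a \<le> b" "b \<le> t1" for a b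
  proof -
    have "{a..b} \<subseteq> {0..t1}"
      using that by auto
    then show ?thesis
      using ac sub \<open>a \<le> b\<close> unfolding locally_absolutely_continuous_on_def by blast
  qed
  have contx: "continuous_on {0..t1} x"
    by (intro absolutely_continuous_imp_continuous_on ac_on) (use \<open>t1 \<ge> 0\<close> in auto)
  have contB: "continuous_on S B" for S
    by (rule locally_lipschitz_imp_continuous_on[OF B(1)])
  have contBx: "continuous_on {0..t1} (\<lambda>t. B (x t))"
    by (rule continuous_on_compose2[OF contB contx]) blast
  define Z where "Z = {t \<in> {0..t1}. B (x t) \<le> 0}"
  have "closed Z"
    unfolding Z_def by (intro continuous_on_closed_Collect_le contBx continuous_intros)
  define t0 where "t0 = Sup Z"
  have "Z \<noteq> {}" "bdd_above Z"
    using B0 \<open>t1 \<ge> 0\<close> by (auto simp: Z_def intro!: bdd_aboveI[of _ t1])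
  then have "t0 \<in> Z"
    unfolding t0_def using \<open>closed Z\<close> by (intro closed_contains_Sup)
  then have t0: "0 \<le> t0" "B (x t0) \<le> 0" "t0 < t1"
    using Bt1 by (auto simp: Z_def order.order_iff_strict)
  have after: "B (x t) > 0" if "t0 < t" "t \<le> t1" for t
  proof (rule ccontr)
    assume "\<not> ?thesis"
    then have "t \<in> Z"
      using that t0 by (auto simp: Z_def)
    then have "t \<le> t0"
      unfolding t0_def by (intro cSup_upper \<open>bdd_above Z\<close>)
    with that show False by simp
  qed
  have inCx: "x t \<in> Cx" if "0 \<le> t" "t < t1" for t
  proof (cases "t = 0")
    case False
    have "{0<..<t1} \<subseteq> interior I"
      using sub by (intro interior_maximal) auto
    moreover have "t \<in> {0<..<t1}"
      using that False by simp
    ultimately show ?thesis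
      using inC by blast
  qed (simp add: \<open>x 0 \<in> Cx\<close>)
  have near: "\<exists>s>t0. s < t1 \<and> (\<forall>t\<in>{t0..s}. x t \<in> V)" if V: "open V" "x t0 \<in> V" for V
  proof -
    obtain W where W: "open W" "t0 \<in> W" "\<And>t. t \<in> {0..t1} \<Longrightarrow> t \<in> W \<Longrightarrow> x t \<in> V"
      using contx V t0 unfolding continuous_on_topological by (metis atLeastAtMost_iff less_imp_le)
    obtain e where e: "e > 0" "ball t0 e \<subseteq> W"
      using W openE by blast
    define s where "s = t0 + min e (t1 - t0) / 2"
    have "s > t0" "s < t1" "s < t0 + e"
      using e t0 by (auto simp: s_def min_def field_simps)
    moreover have "x t \<in> V" if "t \<in> {t0..s}" for t
    proof (rule W(3))
      show "t \<in> {0..t1}" using that t0 \<open>s < t1\<close> by auto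
      show "t \<in> W" using that e \<open>s < t0 + e\<close> by (auto simp: dist_real_def)
    qed
    ultimately show ?thesis by blast
  qed
  have insideK: "B y \<le> 0" if "y \<in> interior ?K" for y
    using that interior_subset[of ?K] unfolding barrier_set_def by blast
  have notK: "x t0 \<notin> interior ?K"
  proof
    assume "x t0 \<in> interior ?K"
    then obtain s where "s > t0" "s < t1" "\<And>t. t \<in> {t0..s} \<Longrightarrow> x t \<in> interior ?K"
      using near[OF open_interior] by blast
    then have "B (x s) \<le> 0"
      by (intro insideK) simp
    with after[of s] \<open>s > t0\<close> \<open>s < t1\<close> show False by simp
  qed
  moreover have "x t0 \<in> ?K"
    using inCx[of t0] t0 by (simp add: barrier_set_def)
  ultimately have "x t0 \<in> A"
    using A(2) closure_subset[of ?K] unfolding frontier_def by blast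
  obtain N L where lip: "L-lipschitz_on N B" and N: "open N" "x t0 \<in> N"
    using B(1) unfolding locally_lipschitz_def by blast
  obtain s where s: "s > t0" "s < t1" and xs: "\<And>t. t \<in> {t0..s} \<Longrightarrow> x t \<in> A \<inter> N"
    using near[of "A \<inter> N"] A(1) N \<open>x t0 \<in> A\<close> by (metis Int_iff open_Int)
  have decr: "clarke_sup B F (x t) (\<kappa> (x t)) < 0" if t: "t \<in> {t0..s}" for t
  proof (rule neg)
    have "x t \<notin> interior ?K"
    proof (cases "t = t0")
      case False
      then have "B (x t) > 0"
        using t s by (intro after) auto
      then show ?thesis
        using insideK[of "x t"] by linarith
    qed (simp add: notK)
    then show "x t \<in> A \<inter> Cx - interior ?K"
      using xs[OF t] inCx[of t] t t0 s by auto
  qed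
  have "B (x s) \<le> B (x t0)"
  proof (rule absolutely_continuous_nonincreasing[where f = "\<lambda>t. B (x t)" and a = t0 and b = s])
    show "t0 \<le> s" using s by simp
    show "absolutely_continuous_on_interval t0 s (\<lambda>t. B (x t))"
      by (rule absolutely_continuous_lipschitz_compose[OF ac_on lip]) (use t0 s xs in auto)
    show "AE t in lebesgue. t \<in> {t0..s} \<longrightarrow>
        (\<exists>d>0. \<forall>l\<in>{t0..t}. \<forall>r\<in>{t..s}. r - l < d \<longrightarrow> B (x r) \<le> B (x l))"
      using ae
    proof eventually_elim
      case (elim t)
      show ?case
      proof
        assume t: "t \<in> {t0..s}"
        have sub': "{t0..s} \<subseteq> I"
          using sub t0 s by auto
        with elim t obtain v where v: "v \<in> F (x t, \<kappa> (x t))"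
          and "(x has_vector_derivative v) (at t within I)"
          by blast
        then have "(x has_vector_derivative v) (at t within {t0..s})"
          using sub' has_vector_derivative_within_subset by blast
        then obtain d where d: "d > 0" "\<And>l r. l \<in> {t0..s} \<Longrightarrow> r \<in> {t0..s} \<Longrightarrow> l \<le> t \<Longrightarrow> t \<le> r \<Longrightarrow>
            r - l < d \<Longrightarrow> B (x r) \<le> B (x l)"
          using decreasing_along_curve[where x = x and F = F and u = "\<kappa> (x t)", OF B(1) t _ v decr[OF t]]
          by blast
        have "B (x r) \<le> B (x l)" if "l \<in> {t0..t}" "r \<in> {t..s}" "r - l < d" for l r
          by (rule d(2)) (use that t in auto)
        with d(1) show "\<exists>d>0. \<forall>l\<in>{t0..t}. \<forall>r\<in>{t..s}. r - l < d \<longrightarrow> B (x r) \<le> B (x l)"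
          by blast
      qed
    qed
  qed
  with after[of s] s t0 show False by simp
qed

theorem theorem1:
  fixes Cx Xo Xu :: "(real ^ 'n) set"
    and Cu :: "(real ^ 'm) set"
    and F :: "(real ^ 'n) \<times> (real ^ 'm) \<Rightarrow> (real ^ 'n) set"
    and \<U> :: "real ^ 'n \<Rightarrow> (real ^ 'm) set"
    and B :: "real ^ 'n \<Rightarrow> real"
  assumes U_maps: "\<forall>x\<in>Cx. \<U> x \<subseteq> Cu"
    and A1: "closed (Cx \<times> Cu)"
    and A2: "set_usc_on (Cx \<times> Cu) F"
      "\<forall>z\<in>Cx \<times> Cu. F z \<noteq> {} \<and> compact (F z) \<and> convex (F z)"
    and A3: "set_lsc_on Cx \<U>"
      "\<forall>x\<in>Cx. \<U> x \<noteq> {} \<and> closed (\<U> x) \<and> convex (\<U> x)"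
    and A4: "convex_in_control Cx Cu F"
    and Xo: "Xo \<subseteq> Cx"
    and disjoint: "Xo \<inter> Xu = {}"
    and cbf: "control_barrier_function Cx F \<U> Xo Xu B"
    and D0: "\<exists>U. open U \<and> frontier (barrier_set Cx B) \<subseteq> U \<and>
      (\<forall>x\<in>(U - interior (barrier_set Cx B)) \<inter> Cx.
         {u \<in> \<U> x. clarke_sup B F x u < 0} \<noteq> {})"
  shows "\<exists>\<kappa> :: real ^ 'n \<Rightarrow> real ^ 'm.
    continuous_on Cx \<kappa> \<and> (\<forall>x\<in>Cx. \<kappa> x \<in> \<U> x) \<and>
    safe_inclusion (\<lambda>x. F (x, \<kappa> x)) Cx Xo Xu"
proof -
  let ?K = "barrier_set Cx B"
  have B: "locally_lipschitz B" "barrier_candidate Xo Xu B"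
    using cbf by (auto simp: control_barrier_function_def)
  obtain U where U: "open U" "frontier ?K \<subseteq> U"
    and D: "\<And>x. x \<in> (U - interior ?K) \<inter> Cx \<Longrightarrow> {u \<in> \<U> x. clarke_sup B F x u < 0} \<noteq> {}"
    using D0 by blast
  have "closed (frontier ?K)" "closed (- U)" "frontier ?K \<inter> - U = {}"
    using U by auto
  then obtain A V where A: "open A" "frontier ?K \<subseteq> A" and V: "open V" "- U \<subseteq> V" "A \<inter> V = {}"
    using separation_normal by metis
  have "closure A \<subseteq> - V"
    using V by (intro closure_minimal) auto
  then have "closure A \<subseteq> U"
    using V by blast
  obtain \<kappa> where \<kappa>: "continuous_on Cx \<kappa>" "\<And>x. x \<in> Cx \<Longrightarrow> \<kappa> x \<in> \<U> x"
    "\<And>x. x \<in> (closure A - interior ?K) \<inter> Cx \<Longrightarrow> clarke_sup B F x (\<kappa> x) < 0"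
  proof (rule decreasing_continuous_control[OF A3(1) _ A2(1) _ A4 B(1)])
    show "\<U> x \<noteq> {} \<and> closed (\<U> x) \<and> convex (\<U> x) \<and> \<U> x \<subseteq> Cu" if "x \<in> Cx" for x
      using A3(2) U_maps that by blast
    show "bounded (F z)" if "z \<in> Cx \<times> Cu" for z
      using A2(2) that by (blast intro: compact_imp_bounded)
    show "closed (closure A - interior ?K)"
      by (intro closed_Diff) auto
    show "{u \<in> \<U> x. clarke_sup B F x u < 0} \<noteq> {}" if "x \<in> (closure A - interior ?K) \<inter> Cx" for x
      by (rule D) (use that \<open>closure A \<subseteq> U\<close> in blast)
  qed blast
  have "safe_inclusion (\<lambda>x. F (x, \<kappa> x)) Cx Xo Xu"
  proof (rule safe_if_decreasing_near_frontier[OF B Xo A])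
    show "clarke_sup B F x (\<kappa> x) < 0" if "x \<in> A \<inter> Cx - interior ?K" for x
      by (rule \<kappa>(3)) (use that closure_subset in blast)
  qed
  with \<kappa> show ?thesis by blast
qed

end
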